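(* Let $A\in\mathbb{R}^{N\times N}$, $C\in\mathbb{R}^{M\times N}$ with $(C,A)$ observable, and let $Q\in\mathbb{R}^{N\times N}$, $R\in\mathbb{R}^{M\times M}$ be symmetric positive definite. Define $I:\mathbb{S}_+^N\to[0,\infty]$ by $$I(X)=\inf_{\mathcal{R}\in\mathcal{S}^{P^\ast}(X)}\pi(\mathcal{R}),\qquad X\in\mathbb{S}_+^N .$$ Then the family of invariant distributions $\{\mu^{\overline{\gamma}}\}$ satisfies a moderate deviations principle at scale $-\ln(1-\overline{\gamma})$ as $\overline{\gamma}\uparrow1$ with good rate function $I$; i.e., $I$ is lower semicontinuous with compact level sets $\{X\mid I(X)\le a\}$, $a\in[0,\infty)$, and $$\liminf_{\overline{\gamma}\uparrow 1}\left(-\frac{1}{\ln(1-\overline{\gamma})}\ln\mu^{\overline{\gamma}}(\mathcal{O})\right)\ge-\inf_{X\in\mathcal{O}}I(X)\quad\text{for every open set }\mathcal{O}\subset\mathbb{S}_+^N,$$ $$\limsup_{\overline{\gamma}\uparrow 1}\left(-\frac{1}{\ln(1-\overline{\gamma})}\ln\mu^{\overline{\gamma}}(\mathcal{F})\right)\le-\inf_{X\in\mathcal{F}}I(X)\quad\text{for every closed set }\mathcal{F}\subset\mathbb{S}_+^N.$$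
   Context: $\mathbb{S}_+^N$ is the set of real symmetric positive semidefinite $N\times N$ matrices with the metric induced by the spectral norm $\|\cdot\|$. Define $f_0,f_1:\mathbb{S}_+^N\to\mathbb{S}_+^N$ by $f_0(X)=AXA^T+Q$ and $f_1(X)=AXA^T+Q-AXC^T(CXC^T+R)^{-1}CXA^T$. $P^\ast$ is the unique fixed point of $f_1$ in $\mathbb{S}_+^N$. For $\overline{\gamma}\in(0,1)$, let $\{\gamma_t\}_{t\ge0}$ be i.i.d. Bernoulli with $\mathbb{P}(\gamma_t=1)=\overline{\gamma}$ and consider the Markov chain $P_{t+1}=f_{\gamma_t}(P_t)$ on $\mathbb{S}_+^N$; $\mu^{\overline{\gamma}}$ is its unique invariant probability measure, to which the law of $P_t$ converges weakly from every initial $P_0\in\mathbb{S}_+^N$ (such a measure exists and is unique under the stated hypotheses). A string of length $t\ge0$ with initial state $P^\ast$ is a formal tuple $\mathcal{R}=(f_{i_1},\dots,f_{i_t},P^\ast)$ with $i_1,\dots,i_t\in\{0,1\}$; its numerical value is $\mathcal{N}(\mathcal{R})=f_{i_1}\circ\cdots\circ f_{i_t}(P^\ast)$ (equal to $P^\ast$ if $t=0$), and $\pi(\mathcal{R})=\#\{j\mid i_j=0\}$ is the number of $f_0$'s in it. $\mathcal{S}^{P^\ast}$ is the set of all strings of arbitrary finite length with initial state $P^\ast$, and $\mathcal{S}^{P^\ast}(X)=\{\mathcal{R}\in\mathcal{S}^{P^\ast}\mid\mathcal{N}(\mathcal{R})=X\}$. Conventions: the infimum of an empty set is $\infty$; $\ln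 0=-\infty$. *)

theory Defs
  imports "HOL-Probability.Probability"
begin

section \<open>Matrices\<close>

definition psd :: "(real^'n^'n) set" where
  "psd = {X. transpose X = X \<and> (\<forall>v. 0 \<le> v \<bullet> (X *v v))}"

definition pos_def :: "real^'n^'n \<Rightarrow> bool" where
  "pos_def X \<longleftrightarrow> transpose X = X \<and> (\<forall>v. v \<noteq> 0 \<longrightarrow> 0 < v \<bullet> (X *v v))"

text \<open>The library's power operation on \<open>real^'n^'n\<close> is componentwise.\<close>

primrec matpow :: "real^'n^'n \<Rightarrow> nat \<Rightarrow> real^'n^'n" where
  "matpow A 0 = mat 1"
| "matpow A (Suc k) = matpow A k ** A"

text \<open>Kalman's rank condition.  The rows of the observability matrix, obtained by stacking
  \<open>C\<close>, \<open>C A\<close>, ..., \<open>C A^(N-1)\<close>, are the rows of these blocks; \<open>dim\<close> of the set of all of them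
  is its (row) rank.\<close>

definition observable :: "real^'n^'m \<Rightarrow> real^'n^'n \<Rightarrow> bool" where
  "observable C A \<longleftrightarrow> dim (\<Union>k<CARD('n). rows (C ** matpow A k)) = CARD('n)"

section \<open>The space of positive semidefinite matrices with the spectral metric\<close>

text \<open>The norm of the type \<open>real^'n^'n\<close> is the Frobenius norm.\<close>

definition spectral_norm :: "real^'n^'n \<Rightarrow> real" where
  "spectral_norm X = onorm ((*v) X)"

definition spectral_dist :: "real^'n^'n \<Rightarrow> real^'n^'n \<Rightarrow> real" where
  "spectral_dist X Y = spectral_norm (X - Y)"

lemma Metric_space_psd: "Metric_space psd spectral_dist"
proof
  fix X Y Z :: "real^'n^'n"
  have bl: "bounded_linear ((*v) W)" for W :: "real^'n^'n"
    by (rule matrix_vector_mul_bounded_linear)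
  show "0 \<le> spectral_dist X Y"
    unfolding spectral_dist_def spectral_norm_def by (rule onorm_pos_le[OF bl])
  have "((*v) (Y - X)) = (\<lambda>v. - ((X - Y) *v v))"
    by (auto simp: matrix_vector_mult_diff_rdistrib)
  then show "spectral_dist X Y = spectral_dist Y X"
    unfolding spectral_dist_def spectral_norm_def by (simp add: onorm_neg)
  have "onorm ((*v) (X - Y)) = 0 \<longleftrightarrow> (\<forall>v. (X - Y) *v v = 0)"
    using onorm_eq_0[OF bl] .
  also have "\<dots> \<longleftrightarrow> X = Y"
    by (auto simp: matrix_eq matrix_vector_mult_diff_rdistrib)
  finally show "spectral_dist X Y = 0 \<longleftrightarrow> X = Y"
    unfolding spectral_dist_def spectral_norm_def .
  have "((*v) (X - Z)) = (\<lambda>v. (X - Y) *v v + (Y - Z) *v v)"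
    by (auto simp: matrix_vector_mult_diff_rdistrib)
  then show "spectral_dist X Z \<le> spectral_dist X Y + spectral_dist Y Z"
    unfolding spectral_dist_def spectral_norm_def
    using onorm_triangle[OF bl[of "X - Y"] bl[of "Y - Z"]] by simp
qed

definition psd_topology :: "(real^'n^'n) topology" where
  "psd_topology = Metric_space.mtopology psd spectral_dist"

definition psd_borel :: "(real^'n^'n) measure" where
  "psd_borel = sigma psd {U. openin psd_topology U}"

definition lower_semicontinuous :: "'a topology \<Rightarrow> ('a \<Rightarrow> ereal) \<Rightarrow> bool" where
  "lower_semicontinuous T f \<longleftrightarrow> (\<forall>x\<in>topspace T. f x \<le> Liminf (atin T x) f)"

section \<open>The random Riccati equation\<close>

definition f0 :: "real^'n^'n \<Rightarrow> real^'n^'n \<Rightarrow> real^'n^'n \<Rightarrow> real^'n^'n" where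
  "f0 A Q X = A ** X ** transpose A + Q"

definition f1 ::
  "real^'n^'n \<Rightarrow> real^'n^'m \<Rightarrow> real^'n^'n \<Rightarrow> real^'m^'m \<Rightarrow> real^'n^'n \<Rightarrow> real^'n^'n" where
  "f1 A C Q R X = A ** X ** transpose A + Q
     - A ** X ** transpose C ** matrix_inv (C ** X ** transpose C + R) ** C ** X ** transpose A"

text \<open>Index 1 is \<open>True\<close>, index 0 is \<open>False\<close>.\<close>

definition f_idx ::
  "real^'n^'n \<Rightarrow> real^'n^'m \<Rightarrow> real^'n^'n \<Rightarrow> real^'m^'m \<Rightarrow> bool \<Rightarrow> real^'n^'n \<Rightarrow> real^'n^'n" where
  "f_idx A C Q R b = (if b then f1 A C Q R else f0 A Q)"

text \<open>Law of \<open>P_{t+1}\<close> given \<open>P_t = X\<close>, where \<open>g\<close> is the probability that \<open>f1\<close> is applied.\<close>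

definition transition_kernel ::
  "real^'n^'n \<Rightarrow> real^'n^'m \<Rightarrow> real^'n^'n \<Rightarrow> real^'m^'m \<Rightarrow> real
     \<Rightarrow> real^'n^'n \<Rightarrow> (real^'n^'n) measure" where
  "transition_kernel A C Q R g X =
     distr (measure_pmf (bernoulli_pmf g)) psd_borel (\<lambda>b. f_idx A C Q R b X)"

definition invariant_distribution ::
  "real^'n^'n \<Rightarrow> real^'n^'m \<Rightarrow> real^'n^'n \<Rightarrow> real^'m^'m \<Rightarrow> real
     \<Rightarrow> (real^'n^'n) measure \<Rightarrow> bool" where
  "invariant_distribution A C Q R g \<mu> \<longleftrightarrow>
     prob_space \<mu> \<and> sets \<mu> = sets psd_borel \<and>
     (\<forall>B\<in>sets psd_borel.
        emeasure \<mu> B = (\<integral>\<^sup>+ X. emeasure (transition_kernel A C Q R g X) B \<partial>\<mu>))"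

section \<open>Strings\<close>

text \<open>\<open>([i\<^sub>1, \<dots>, i\<^sub>t], X)\<close> stands for the formal tuple \<open>(f\<^bsub>i\<^sub>1\<^esub>, \<dots>, f\<^bsub>i\<^sub>t\<^esub>, X)\<close>.\<close>

type_synonym 'n riccati_string = "bool list \<times> (real^'n^'n)"

definition strings :: "real^'n^'n \<Rightarrow> 'n riccati_string set" where
  "strings P0 = {S. snd S = P0}"

definition numerical_value ::
  "real^'n^'n \<Rightarrow> real^'n^'m \<Rightarrow> real^'n^'n \<Rightarrow> real^'m^'m \<Rightarrow> 'n riccati_string \<Rightarrow> real^'n^'n" where
  "numerical_value A C Q R S = foldr (f_idx A C Q R) (fst S) (snd S)"

definition num_f0 :: "'n riccati_string \<Rightarrow> nat" where
  "num_f0 S = card {j. j < length (fst S) \<and> fst S ! j = False}"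

definition strings_of_value ::
  "real^'n^'n \<Rightarrow> real^'n^'m \<Rightarrow> real^'n^'n \<Rightarrow> real^'m^'m \<Rightarrow> real^'n^'n \<Rightarrow> real^'n^'n
     \<Rightarrow> 'n riccati_string set" where
  "strings_of_value A C Q R P0 X = {S \<in> strings P0. numerical_value A C Q R S = X}"

definition rate ::
  "real^'n^'n \<Rightarrow> real^'n^'m \<Rightarrow> real^'n^'n \<Rightarrow> real^'m^'m \<Rightarrow> real^'n^'n \<Rightarrow> real^'n^'n \<Rightarrow> ereal" where
  "rate A C Q R Pstar X = (INF S\<in>strings_of_value A C Q R Pstar X. ereal (real (num_f0 S)))"

section \<open>Extended logarithm\<close>

definition ln_ext :: "real \<Rightarrow> ereal" where
  "ln_ext x = (if x = 0 then -\<infinity> else ereal (ln x))"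

end

theory Submission
  imports Defs "HOL-Real_Asymp.Real_Asymp"
begin

text \<open>Write \<open>w\<^sup>T X w\<close> as a quadratic form.  Then \<open>w\<^sup>T f\<^sub>1(X) w\<close> is the minimum over \<open>y\<close> of
  \<open>(A\<^sup>T w + C\<^sup>T y)\<^sup>T X (A\<^sup>T w + C\<^sup>T y) + w\<^sup>T Q w + y\<^sup>T R y\<close>.  Choosing \<open>y\<close> suitably over \<open>N\<close> steps,
  observability makes the \<open>N\<close>-th iterate of \<open>f\<^sub>1\<close> bounded uniformly in \<open>X\<close>; concavity together with
  \<open>Q > 0\<close> makes the order bounds \<open>(1 - e) P \<le> X \<le> (1 + e') P\<close> around the fixed point \<open>P\<close> contract
  geometrically.  Hence the iterates of \<open>f\<^sub>1\<close> converge to \<open>P\<close> uniformly on all of the state space.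

  Let \<open>K\<^sub>n\<close> be the set of values of strings with fewer than \<open>n\<close> letters \<open>f\<^sub>0\<close>, so that \<open>K\<^sub>n\<^sub>+\<^sub>1\<close> consists of
  \<open>P\<close> and the sets \<open>f\<^sub>1\<^sup>k(f\<^sub>0(K\<^sub>n))\<close>.  Uniform convergence makes it compact.  If a closed set \<open>E\<close> misses
  \<open>K\<^sub>n\<^sub>+\<^sub>1\<close>, then some iterate of \<open>f\<^sub>1\<close> maps everything outside \<open>E\<close>; by stationarity \<open>\<mu>(E)\<close> is at most
  \<open>1 - g\<close> times a finite sum of masses of closed sets that miss \<open>K\<^sub>n\<close>, whence
  \<open>\<mu>(E) = O((1 - g)\<^sup>n\<^sup>+\<^sup>1)\<close> by induction.
  Conversely, if the value of a string with \<open>n\<close> letters \<open>f\<^sub>0\<close> lies in an open set, then after appending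
  enough letters \<open>f\<^sub>1\<close> the string maps every initial state into that set, which therefore has mass at
  least a constant times \<open>(1 - g)\<^sup>n\<close>.\<close>

section \<open>Quadratic forms\<close>

definition qf :: "real^'n^'n \<Rightarrow> real^'n \<Rightarrow> real" where
  "qf X v = v \<bullet> (X *v v)"

lemma qf_add_matrix: "qf (X + Y) v = qf X v + qf Y v"
  by (simp add: qf_def matrix_vector_mult_add_rdistrib inner_add_right)

lemma qf_diff_matrix: "qf (X - Y) v = qf X v - qf Y v"
  by (simp add: qf_def matrix_vector_mult_diff_rdistrib inner_diff_right)

lemma inner_symmetric_matrix:
  fixes X :: "real^'n^'n"
  assumes "transpose X = X"
  shows "x \<bullet> (X *v y) = y \<bullet> (X *v x)"
  by (metis assms dot_lmul_matrix inner_commute transpose_matrix_vector)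

lemma qf_add:
  assumes "transpose X = X"
  shows "qf X (v + w) = qf X v + 2 * (v \<bullet> (X *v w)) + qf X w"
  unfolding qf_def
  using inner_symmetric_matrix[OF assms, of w v]
  by (simp add: matrix_vector_right_distrib inner_add_left inner_add_right)

lemma psd_iff: "X \<in> psd \<longleftrightarrow> transpose X = X \<and> (\<forall>v. 0 \<le> qf X v)"
  by (simp add: psd_def qf_def)

lemma pos_def_iff: "pos_def X \<longleftrightarrow> transpose X = X \<and> (\<forall>v. v \<noteq> 0 \<longrightarrow> 0 < qf X v)"
  by (simp add: pos_def_def qf_def)

lemma qf_zero [simp]: "qf X 0 = 0"
  by (simp add: qf_def)

lemma pos_def_imp_psd: "pos_def X \<Longrightarrow> X \<in> psd"
  unfolding pos_def_iff psd_iff by (metis less_le order_refl qf_zero)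

lemma qf_nonneg: "X \<in> psd \<Longrightarrow> 0 \<le> qf X v"
  by (simp add: psd_iff)

lemma transpose_add: "transpose (X + Y) = transpose X + transpose (Y :: real^'n^'m)"
  by (simp add: transpose_def vec_eq_iff)

lemma transpose_diff: "transpose (X - Y) = transpose X - transpose (Y :: real^'n^'m)"
  by (simp add: transpose_def vec_eq_iff)

lemma psd_add: "X \<in> psd \<Longrightarrow> Y \<in> psd \<Longrightarrow> X + Y \<in> psd"
  by (simp add: psd_iff transpose_add qf_add_matrix)

lemma qf_congruence: "qf (B ** X ** transpose B) w = qf X (w v* B)"
  by (simp add: qf_def dot_lmul_matrix flip: matrix_vector_mul_assoc)

lemma psd_congruence:
  assumes "X \<in> psd"
  shows "B ** X ** transpose B \<in> psd"
  using assms by (simp add: psd_iff qf_congruence matrix_transpose_mul matrix_mul_assoc)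

lemma qf_le_norm: "\<bar>qf X v\<bar> \<le> onorm ((*v) X) * (norm v)\<^sup>2"
proof -
  have "\<bar>qf X v\<bar> \<le> norm v * norm (X *v v)"
    unfolding qf_def by (rule Cauchy_Schwarz_ineq2)
  also have "\<dots> \<le> norm v * (onorm ((*v) X) * norm v)"
    by (intro mult_left_mono onorm matrix_vector_mul_bounded_linear) auto
  finally show ?thesis
    by (simp add: power2_eq_square algebra_simps)
qed

text \<open>The constant is the minimum of the form on the unit sphere: compactness attains it at a
  nonzero vector, so it is positive, and homogeneity of degree two carries the bound to every
  \<open>v\<close>.\<close>

lemma pos_def_lower_bound:
  fixes X :: "real^'n^'n"
  assumes "pos_def X"
  obtains p where "0 < p" "\<And>v. p * (norm v)\<^sup>2 \<le> qf X v"
proof -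
  have "continuous_on (sphere 0 1) (qf X)"
    unfolding qf_def by (intro continuous_intros linear_continuous_on matrix_vector_mul_bounded_linear)
  moreover have "sphere (0::real^'n) 1 \<noteq> {}" by simp
  ultimately obtain u where u: "u \<in> sphere 0 1" "\<And>v. v \<in> sphere 0 1 \<Longrightarrow> qf X u \<le> qf X v"
    using continuous_attains_inf[of "sphere (0::real^'n) 1" "qf X"] by auto
  have "0 < qf X u"
    using assms u(1) unfolding pos_def_iff by (metis dist_0_norm mem_sphere norm_zero zero_neq_one)
  moreover have "qf X u * (norm v)\<^sup>2 \<le> qf X v" for v
  proof (cases "v = 0")
    case False
    have "qf X u \<le> qf X (v /\<^sub>R norm v)"
      using False by (intro u(2)) simp
    also have "\<dots> = qf X v / (norm v)\<^sup>2"
      by (simp add: qf_def matrix_vector_mult_scaleR power2_eq_square divide_simps)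
    finally show ?thesis
      using False by (simp add: field_simps)
  qed simp
  ultimately show ?thesis
    using that by blast
qed

section \<open>Controlling a symmetric matrix by values of its quadratic form\<close>

lemma norm_matrix_le_entries:
  fixes X :: "real^'n^'m"
  assumes "\<And>i j. \<bar>X $ i $ j\<bar> \<le> B"
  shows "norm X \<le> real CARD('m) * (real CARD('n) * B)"
proof -
  have "norm (X $ i) \<le> real CARD('n) * B" for i
    using norm_le_l1_cart[of "X $ i"] sum_bounded_above[of UNIV "\<lambda>j. \<bar>X $ i $ j\<bar>" B] assms
    by fastforce
  then have "(\<Sum>i\<in>UNIV. norm (X $ i)) \<le> real CARD('m) * (real CARD('n) * B)"
    using sum_bounded_above[of UNIV "\<lambda>i. norm (X $ i)" "real CARD('n) * B"] by simp
  then show ?thesis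
    unfolding norm_vec_def[of X] using L2_set_le_sum[of UNIV "\<lambda>i. norm (X $ i)"] by fastforce
qed

lemma entry_eq_inner: "(X :: real^'n^'m) $ i $ j = axis i 1 \<bullet> (X *v axis j 1)"
  by (simp add: inner_axis' matrix_vector_mult_basis column_def)

text \<open>Polarization recovers each entry from three values of the form. Only finitely many test
  vectors occur, so bounds that depend on the vector still give a bound on the norm.\<close>

lemma norm_matrix_le_qf:
  fixes Z :: "real^'n^'n"
  assumes "transpose Z = Z" and "\<And>i j. \<bar>qf Z (axis i 1 + axis j 1)\<bar> \<le> B" "\<And>i. \<bar>qf Z (axis i 1)\<bar> \<le> B"
  shows "norm Z \<le> real CARD('n) * (real CARD('n) * (2 * B))"
proof (rule norm_matrix_le_entries)
  fix i j
  have "qf Z (axis i 1 + axis j 1) = qf Z (axis i 1) + 2 * Z $ i $ j + qf Z (axis j 1)"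
    by (simp add: qf_add[OF assms(1)] entry_eq_inner)
  then show "\<bar>Z $ i $ j\<bar> \<le> 2 * B"
    using assms(2)[of i j] assms(3)[of i] assms(3)[of j] by linarith
qed

text \<open>The test vectors have norm at most 2, so \<open>B = 4 * e\<close> serves in
  \<open>norm_matrix_le_qf\<close>.\<close>

lemma norm_matrix_le_qf_bound:
  fixes Z :: "real^'n^'n"
  assumes "transpose Z = Z" and "\<And>v. \<bar>qf Z v\<bar> \<le> e * (norm v)\<^sup>2" and "0 \<le> e"
  shows "norm Z \<le> real CARD('n) * (real CARD('n) * (8 * e))"
proof -
  have "\<bar>qf Z (axis i 1 + axis j 1)\<bar> \<le> 4 * e" for i j
  proof -
    have "norm (axis i 1 + axis j 1 :: real^'n) \<le> 2"
      using norm_triangle_ineq[of "axis i 1 :: real^'n" "axis j 1"] by simp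
    then have "(norm (axis i 1 + axis j 1 :: real^'n))\<^sup>2 \<le> 2\<^sup>2"
      by (intro power_mono) auto
    then have "e * (norm (axis i 1 + axis j 1 :: real^'n))\<^sup>2 \<le> e * 2\<^sup>2"
      using assms(3) by (intro mult_left_mono) auto
    then show ?thesis
      using assms(2)[of "axis i 1 + axis j 1"] by simp
  qed
  moreover have "\<bar>qf Z (axis i 1)\<bar> \<le> 4 * e" for i
    using assms(2)[of "axis i 1"] assms(3) by simp
  ultimately show ?thesis
    using norm_matrix_le_qf[of Z "4 * e"] assms(1) by simp
qed

section \<open>The topology of the space of positive semidefinite matrices\<close>

lemma spectral_norm_le: "spectral_norm X \<le> real CARD('n) * real CARD('n) * norm (X :: real^'n^'n)"
  unfolding spectral_norm_def
  by (intro onorm_le_matrix_component)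
    (metis Finite_Cartesian_Product.norm_nth_le order_trans real_norm_def)

lemma norm_le_spectral_norm: "norm X \<le> real CARD('n) * (real CARD('n) * spectral_norm (X :: real^'n^'n))"
  unfolding spectral_norm_def
  by (intro norm_matrix_le_entries matrix_component_le_onorm)

text \<open>The spectral and Frobenius norms bound each other up to the factor N^2, so their balls
  are nested. From here on all topology is that of a subspace of a Euclidean space.\<close>

lemma psd_topology_eq: "(psd_topology :: (real^'n^'n) topology) = top_of_set psd"
proof (rule topology_eq[THEN iffD2], intro allI)
  fix U :: "(real^'n^'n) set"
  interpret Metric_space "psd :: (real^'n^'n) set" spectral_dist
    by (rule Metric_space_psd)
  define c where "c = real CARD('n) * real CARD('n)"
  have c: "0 < c" by (simp add: c_def)
  have 1: "spectral_dist x y < c * e" if "dist y x < e" for x y :: "real^'n^'n" and e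
  proof -
    have "spectral_dist x y \<le> c * norm (x - y)"
      unfolding spectral_dist_def c_def by (rule spectral_norm_le)
    also have "\<dots> < c * e"
      using that c by (simp add: dist_norm norm_minus_commute)
    finally show ?thesis .
  qed
  have 2: "dist y x < c * e" if "spectral_dist x y < e" for x y :: "real^'n^'n" and e
  proof -
    have "norm (x - y) \<le> c * spectral_dist x y"
      unfolding spectral_dist_def c_def mult.assoc by (rule norm_le_spectral_norm)
    also have "\<dots> < c * e"
      using that c by simp
    finally show ?thesis
      by (simp add: dist_norm norm_minus_commute)
  qed
  have "(\<exists>r>0. mball x r \<subseteq> U) \<longleftrightarrow> (\<exists>e>0. \<forall>y\<in>psd. dist y x < e \<longrightarrow> y \<in> U)"
    if "U \<subseteq> psd" "x \<in> U" for x
  proof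
    assume "\<exists>r>0. mball x r \<subseteq> U"
    then obtain r where r: "r > 0" "mball x r \<subseteq> U" by blast
    have "y \<in> U" if y: "y \<in> psd" "dist y x < r / c" for y
    proof -
      have "c * (r / c) = r"
        using c by simp
      then have "spectral_dist x y < r"
        using 1[OF y(2)] by simp
      then have "y \<in> mball x r"
        unfolding in_mball using y(1) \<open>U \<subseteq> psd\<close> \<open>x \<in> U\<close> by blast
      then show ?thesis
        using r(2) by blast
    qed
    then show "\<exists>e>0. \<forall>y\<in>psd. dist y x < e \<longrightarrow> y \<in> U"
      using r(1) c by (intro exI[of _ "r / c"]) simp
  next
    assume "\<exists>e>0. \<forall>y\<in>psd. dist y x < e \<longrightarrow> y \<in> U"
    then obtain e where e: "e > 0" "\<And>y. y \<in> psd \<Longrightarrow> dist y x < e \<Longrightarrow> y \<in> U" by blast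
    have "mball x (e / c) \<subseteq> U"
    proof
      fix y assume y: "y \<in> mball x (e / c)"
      then have "y \<in> psd" "dist y x < c * (e / c)"
        using 2[of x y "e / c"] unfolding in_mball by blast+
      then show "y \<in> U"
        using e(2)[of y] c by simp
    qed
    then show "\<exists>r>0. mball x r \<subseteq> U"
      using e(1) c by (intro exI[of _ "e / c"]) simp
  qed
  then show "openin psd_topology U \<longleftrightarrow> openin (top_of_set psd) U"
    unfolding psd_topology_def openin_mtopology openin_euclidean_subtopology_iff by blast
qed

lemma space_psd_borel [simp]: "space psd_borel = (psd :: (real^'n^'n) set)"
  and sets_psd_borel: "sets (psd_borel :: (real^'n^'n) measure) = sigma_sets psd {U. openin (top_of_set psd) U}"
proof -
  have "{U. openin (top_of_set psd) U} \<subseteq> Pow (psd :: (real^'n^'n) set)"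
    using openin_imp_subset by auto
  then show "space psd_borel = (psd :: (real^'n^'n) set)"
    "sets (psd_borel :: (real^'n^'n) measure) = sigma_sets psd {U. openin (top_of_set psd) U}"
    by (simp_all add: psd_borel_def psd_topology_eq space_measure_of_conv sets_measure_of)
qed

section \<open>The Riccati map\<close>

lemma invertible_pos_def: "pos_def S \<Longrightarrow> invertible S"
  unfolding invertible_left_inverse matrix_left_invertible_ker pos_def_iff qf_def
  by (metis inner_zero_right less_irrefl)

lemma matrix_inv_inverse:
  assumes "invertible S"
  shows "S ** matrix_inv S = mat 1" "matrix_inv S ** S = mat 1"
  using someI_ex[OF assms[unfolded invertible_def]] unfolding matrix_inv_def by auto

lemma transpose_matrix_inv:
  fixes S :: "real^'n^'n"
  assumes "invertible S" "transpose S = S"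
  shows "transpose (matrix_inv S) = matrix_inv S"
proof -
  have "transpose (matrix_inv S) ** S = mat 1"
    using matrix_inv_inverse(1)[OF assms(1)] assms(2) by (metis matrix_transpose_mul transpose_mat)
  then show ?thesis
    using matrix_inv_inverse(1)[OF assms(1)] by (metis matrix_mul_assoc matrix_mul_lid matrix_mul_rid)
qed

lemma bounded_linear_vector_matrix_mult: "bounded_linear (\<lambda>w. w v* (A :: real^'n^'m))"
  unfolding linear_conv_bounded_linear[symmetric]
  by (rule linearI) (simp_all add: vector_matrix_left_distrib scaleR_vector_matrix_assoc)

lemma matrix_add_rdistrib: "(A + B) ** D = A ** D + B ** (D :: real^'k^'n)"
  by (simp add: matrix_eq matrix_vector_mult_add_rdistrib flip: matrix_vector_mul_assoc)

section \<open>Powers of \<open>A\<close> and the rows of the observability matrix\<close>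

lemma matpow_commute: "A ** matpow A k = matpow A (Suc k)"
  by (induction k) (simp_all add: matrix_mul_assoc)

lemma row_eq_vector_matrix_mult: "row i M = axis i 1 v* (M :: real^'n^'m)"
  by (simp add: matrix_vector_mult_basis column_def row_def transpose_def flip: transpose_matrix_vector)

text \<open>The sums on the right form a subspace \<open>T\<close>; it contains every row, since row
  \<open>i\<close> of a block is the block multiplied from the left by \<open>axis i 1\<close>. The
  coefficients \<open>y j\<close> will serve as the free choices in successive applications of
  \<open>f1\<close>.\<close>

lemma span_rows_observability:
  fixes A :: "real^'n^'n" and C :: "real^'n^'m"
  assumes "z \<in> span (\<Union>j<k. rows (C ** matpow A j))"
  obtains y where "z = (\<Sum>j<k. y j v* (C ** matpow A j))"
proof -
  define T where "T = range (\<lambda>y. \<Sum>j<k. y j v* (C ** matpow A j))"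
  have "subspace T"
  proof (rule subspaceI)
    show "0 \<in> T"
      unfolding T_def by (rule range_eqI[of _ _ "\<lambda>_. 0"]) simp
    show "x + x' \<in> T" if x: "x \<in> T" and x': "x' \<in> T" for x x'
    proof -
      obtain y where "x = (\<Sum>j<k. y j v* (C ** matpow A j))"
        using x[unfolded T_def] by (rule rangeE)
      moreover obtain y' where "x' = (\<Sum>j<k. y' j v* (C ** matpow A j))"
        using x'[unfolded T_def] by (rule rangeE)
      ultimately show ?thesis
        unfolding T_def
        by (intro range_eqI[of _ _ "\<lambda>j. y j + y' j"]) (simp add: vector_matrix_left_distrib sum.distrib)
    qed
    show "c *\<^sub>R x \<in> T" if x: "x \<in> T" for c x
    proof -
      obtain y where "x = (\<Sum>j<k. y j v* (C ** matpow A j))"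
        using x[unfolded T_def] by (rule rangeE)
      then show ?thesis
        unfolding T_def
        by (intro range_eqI[of _ _ "\<lambda>j. c *\<^sub>R y j"]) (simp add: scaleR_vector_matrix_assoc scaleR_sum_right)
    qed
  qed
  moreover have "row i (C ** matpow A j) \<in> T" if "j < k" for i j
  proof -
    have "(\<Sum>l<k. (if l = j then axis i 1 else 0) v* (C ** matpow A l))
        = (\<Sum>l<k. if l = j then axis i 1 v* (C ** matpow A j) else 0)"
      by (intro sum.cong) auto
    then show ?thesis
      unfolding T_def row_eq_vector_matrix_mult using that
      by (intro range_eqI[of _ _ "\<lambda>l. if l = j then axis i 1 else 0"]) simp
  qed
  ultimately have "span (\<Union>j<k. rows (C ** matpow A j)) \<subseteq> T"
    by (intro span_minimal) (auto simp: rows_def)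
  then show ?thesis
    using assms that unfolding T_def by blast
qed

section \<open>The Riccati map as a minimum, and its order bounds\<close>

locale riccati =
  fixes A Q :: "real^'n^'n" and C :: "real^'n^'m" and R :: "real^'m^'m"
  assumes pos_def_Q: "pos_def Q" and pos_def_R: "pos_def R"
begin

abbreviation F0 :: "real^'n^'n \<Rightarrow> real^'n^'n" where "F0 \<equiv> f0 A Q"
abbreviation F1 :: "real^'n^'n \<Rightarrow> real^'n^'n" where "F1 \<equiv> f1 A C Q R"

lemma Q_psd: "Q \<in> psd" and R_psd: "R \<in> psd"
  by (simp_all add: pos_def_imp_psd pos_def_Q pos_def_R)

lemma F0_psd: "X \<in> psd \<Longrightarrow> F0 X \<in> psd"
  unfolding f0_def by (intro psd_add psd_congruence Q_psd)

lemma pos_def_innovation: "X \<in> psd \<Longrightarrow> pos_def (C ** X ** transpose C + R)"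
  using pos_def_R unfolding pos_def_iff psd_iff
  by (auto simp: transpose_add matrix_transpose_mul matrix_mul_assoc qf_add_matrix qf_congruence
      intro!: add_nonneg_pos)

text \<open>Completing the square in \<open>y\<close> exhibits the Riccati form as a minimum over \<open>y\<close>.\<close>

lemma F1_completed_square:
  assumes "X \<in> psd"
  defines "S \<equiv> C ** X ** transpose C + R"
  shows "qf (F1 X) w + qf S (y + matrix_inv S *v (C *v (X *v (w v* A))))
    = qf X (w v* A + y v* C) + qf Q w + qf R y"
proof -
  let ?b = "C *v (X *v (w v* A))"
  have X: "transpose X = X" and R: "transpose R = R"
    using assms(1) R_psd by (simp_all add: psd_iff)
  have S: "transpose S = S" "invertible S"
    using pos_def_innovation[OF assms(1)] invertible_pos_def unfolding S_def pos_def_iff by blast+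
  have "S *v (matrix_inv S *v ?b) = ?b"
    by (simp add: matrix_vector_mul_assoc[of S] matrix_inv_inverse[OF S(2)])
  then have sq: "qf S (y + matrix_inv S *v ?b) = qf S y + 2 * (y \<bullet> ?b) + ?b \<bullet> (matrix_inv S *v ?b)"
    by (subst qf_add[OF S(1)]) (simp add: qf_def inner_commute)
  have "w \<bullet> ((A ** X ** transpose C ** matrix_inv S ** C ** X ** transpose A) *v w)
      = ?b \<bullet> (matrix_inv S *v ?b)"
  proof -
    have "w \<bullet> ((A ** X ** transpose C ** matrix_inv S ** C ** X ** transpose A) *v w)
      = w \<bullet> (A *v (X *v (transpose C *v (matrix_inv S *v ?b))))"
      by (simp flip: matrix_vector_mul_assoc)
    also have "\<dots> = (w v* A) \<bullet> (X *v (transpose C *v (matrix_inv S *v ?b)))"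
      by (simp add: dot_lmul_matrix)
    also have "\<dots> = (transpose C *v (matrix_inv S *v ?b)) \<bullet> (X *v (w v* A))"
      by (rule inner_symmetric_matrix[OF X])
    also have "\<dots> = (matrix_inv S *v ?b) \<bullet> ?b"
      by (simp add: dot_lmul_matrix)
    finally show ?thesis
      by (simp add: inner_commute)
  qed
  then have "qf (F1 X) w = qf X (w v* A) + qf Q w - ?b \<bullet> (matrix_inv S *v ?b)"
    unfolding f1_def S_def[symmetric] qf_diff_matrix qf_add_matrix qf_congruence by (simp add: qf_def)
  moreover have "qf X (w v* A + y v* C) = qf X (w v* A) + 2 * (y \<bullet> ?b) + qf X (y v* C)"
    using qf_add[OF X, of "y v* C" "w v* A"] by (simp add: dot_lmul_matrix add.commute)
  moreover have "qf S y = qf X (y v* C) + qf R y"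
    by (simp add: S_def qf_add_matrix qf_congruence)
  ultimately show ?thesis
    using sq by simp
qed

lemma F1_le:
  assumes "X \<in> psd"
  shows "qf (F1 X) w \<le> qf X (w v* A + y v* C) + qf Q w + qf R y"
  using F1_completed_square[OF assms, of w y]
    qf_nonneg[OF pos_def_imp_psd[OF pos_def_innovation[OF assms]],
      of "y + matrix_inv (C ** X ** transpose C + R) *v (C *v (X *v (w v* A)))"]
  by linarith

text \<open>The minimizer is the \<open>y\<close> at which the square in
  \<open>F1_completed_square\<close> vanishes.\<close>

lemma F1_attained:
  assumes "X \<in> psd"
  obtains y where "qf (F1 X) w = qf X (w v* A + y v* C) + qf Q w + qf R y"
proof
  let ?S = "C ** X ** transpose C + R"
  show "qf (F1 X) w = qf X (w v* A + (- (matrix_inv ?S *v (C *v (X *v (w v* A))))) v* C) + qf Q w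
      + qf R (- (matrix_inv ?S *v (C *v (X *v (w v* A)))))"
    using F1_completed_square[OF assms, of w "- (matrix_inv ?S *v (C *v (X *v (w v* A))))"] by simp
qed

lemma transpose_F1:
  assumes "X \<in> psd"
  shows "transpose (F1 X) = F1 X"
proof -
  have S: "pos_def (C ** X ** transpose C + R)"
    by (rule pos_def_innovation[OF assms])
  show ?thesis
    unfolding f1_def transpose_diff transpose_add matrix_transpose_mul
    using assms Q_psd S transpose_matrix_inv[OF invertible_pos_def[OF S]]
    by (simp add: psd_iff pos_def_iff matrix_mul_assoc)
qed

lemma F1_psd:
  assumes "X \<in> psd"
  shows "F1 X \<in> psd"
proof -
  have "0 \<le> qf (F1 X) w" for w
    using F1_attained[OF assms, of w] qf_nonneg[OF assms] qf_nonneg[OF Q_psd] qf_nonneg[OF R_psd]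
    by (metis add_nonneg_nonneg)
  then show ?thesis
    by (simp add: psd_iff transpose_F1[OF assms])
qed

lemma F1_iterate_psd: "X \<in> psd \<Longrightarrow> (F1 ^^ k) X \<in> psd"
  by (induction k) (auto intro: F1_psd)

text \<open>The \<open>y\<close> optimal for \<open>Y\<close> is also admissible for
  \<open>X\<close>. Scaling by \<open>c\<close> scales the costs of \<open>X\<close>,
  \<open>Q\<close> and \<open>R\<close> alike, while the full cost of \<open>Q\<close> is paid in
  \<open>F1 Y\<close>; the surplus \<open>(1 - c) * qf Q w\<close> is the source of the
  contraction.\<close>

lemma F1_lower:
  assumes "X \<in> psd" "Y \<in> psd" "0 \<le> c" "c \<le> 1" "\<And>v. c * qf X v \<le> qf Y v"
  shows "c * qf (F1 X) w + (1 - c) * qf Q w \<le> qf (F1 Y) w"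
proof -
  obtain y where y: "qf (F1 Y) w = qf Y (w v* A + y v* C) + qf Q w + qf R y"
    using F1_attained[OF assms(2)] .
  have "c * qf (F1 X) w \<le> c * (qf X (w v* A + y v* C) + qf Q w + qf R y)"
    using assms(3) F1_le[OF assms(1)] by (intro mult_left_mono) auto
  moreover have "c * qf R y \<le> 1 * qf R y"
    using assms(4) qf_nonneg[OF R_psd] by (intro mult_right_mono) auto
  ultimately show ?thesis
    using assms(5)[of "w v* A + y v* C"] unfolding y by (simp add: algebra_simps)
qed

text \<open>The mirror image of \<open>F1_lower\<close>: now the \<open>y\<close> optimal for
  \<open>X\<close> is tried in \<open>F1 Y\<close>.\<close>

lemma F1_upper:
  assumes "X \<in> psd" "Y \<in> psd" "1 \<le> d" "\<And>v. qf Y v \<le> d * qf X v"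
  shows "qf (F1 Y) w \<le> d * qf (F1 X) w - (d - 1) * qf Q w"
proof -
  obtain y where y: "qf (F1 X) w = qf X (w v* A + y v* C) + qf Q w + qf R y"
    using F1_attained[OF assms(1)] .
  have "1 * qf R y \<le> d * qf R y"
    using assms(3) qf_nonneg[OF R_psd] by (intro mult_right_mono) auto
  then show ?thesis
    using F1_le[OF assms(2), of w y] assms(4)[of "w v* A + y v* C"] unfolding y
    by (simp add: algebra_simps)
qed

section \<open>Continuity\<close>

lemma continuous_on_F0: "continuous_on S F0"
proof -
  have "bounded_linear (\<lambda>X. A ** X ** transpose A)"
    unfolding linear_conv_bounded_linear[symmetric]
    by (intro linearI) (simp_all add: matrix_add_ldistrib matrix_add_rdistrib matrix_scalar_ac
        scalar_matrix_assoc)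
  then have "continuous_on S (\<lambda>X. A ** X ** transpose A + Q)"
    by (intro continuous_intros linear_continuous_on)
  then show ?thesis
    by (simp add: f0_def[abs_def])
qed

lemma qf_le_frobenius: "qf X v \<le> real CARD('n) * real CARD('n) * norm X * (norm v)\<^sup>2"
  for X :: "real^'n^'n"
  using qf_le_norm[of X v] mult_right_mono[OF spectral_norm_le[of X], of "(norm v)\<^sup>2"]
  unfolding spectral_norm_def by simp

text \<open>Trying the \<open>y\<close> optimal for \<open>X\<close> in \<open>F1 Y\<close> leaves
  only the form of \<open>Y - X\<close> at \<open>w v* A + y v* C\<close>. That vector is bounded by
  a multiple of \<open>norm w\<close>: comparison with the choice 0 bounds the minimal cost by
  \<open>s * (norm w)\<^sup>2\<close>, and \<open>R\<close> is bounded below by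
  \<open>r\<close>.\<close>

lemma F1_one_sided_lipschitz:
  assumes "0 \<le> b"
  obtains K where "0 \<le> K"
    "\<And>X Y w. X \<in> psd \<Longrightarrow> Y \<in> psd \<Longrightarrow> norm X \<le> b \<Longrightarrow>
      qf (F1 Y) w - qf (F1 X) w \<le> K * norm (Y - X) * (norm w)\<^sup>2"
proof -
  obtain a where a: "0 < a" "\<And>w. norm (w v* A) \<le> norm w * a"
    using bounded_linear.pos_bounded[OF bounded_linear_vector_matrix_mult] by blast
  obtain c where c: "0 < c" "\<And>y. norm (y v* C) \<le> norm y * c"
    using bounded_linear.pos_bounded[OF bounded_linear_vector_matrix_mult] by blast
  obtain r where r: "0 < r" "\<And>v. r * (norm v)\<^sup>2 \<le> qf R v"
    using pos_def_lower_bound[OF pos_def_R] by blast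
  let ?m = "real CARD('n) * real CARD('n)"
  define s where "s = ?m * b * a\<^sup>2 + ?m * norm Q"
  define K where "K = ?m * (a + sqrt (s / r) * c)\<^sup>2"
  have s: "0 \<le> s"
    using assms by (simp add: s_def)
  have "qf (F1 Y) w - qf (F1 X) w \<le> K * norm (Y - X) * (norm w)\<^sup>2"
    if X: "X \<in> psd" "norm X \<le> b" and Y: "Y \<in> psd" for X Y w
  proof -
    obtain y where y: "qf (F1 X) w = qf X (w v* A + y v* C) + qf Q w + qf R y"
      using F1_attained[OF X(1)] .
    have "r * (norm y)\<^sup>2 \<le> qf (F1 X) w"
      using r(2)[of y] qf_nonneg[OF X(1), of "w v* A + y v* C"] qf_nonneg[OF Q_psd, of w] y by linarith
    also have "\<dots> \<le> qf X (w v* A) + qf Q w"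
      using F1_le[OF X(1), of w 0] by simp
    also have "qf X (w v* A) \<le> ?m * norm X * (norm (w v* A))\<^sup>2"
      by (rule qf_le_frobenius)
    also have "\<dots> \<le> ?m * b * (norm w * a)\<^sup>2"
      using X(2) a assms by (intro mult_mono power_mono) auto
    also have "qf Q w \<le> ?m * norm Q * (norm w)\<^sup>2"
      by (rule qf_le_frobenius)
    finally have "(norm y)\<^sup>2 \<le> s / r * (norm w)\<^sup>2"
      using r(1) by (simp add: s_def field_simps)
    then have "norm y \<le> sqrt (s / r) * norm w"
      using s r(1) by (metis norm_ge_zero real_le_rsqrt real_sqrt_abs2 real_sqrt_mult
          power2_eq_square abs_of_nonneg)
    then have "norm y * c \<le> sqrt (s / r) * norm w * c"
      using c(1) by simp
    then have "norm (w v* A + y v* C) \<le> (a + sqrt (s / r) * c) * norm w"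
      using norm_triangle_ineq[of "w v* A" "y v* C"] a(2)[of w] c(2)[of y] by (simp add: algebra_simps)
    then have "(norm (w v* A + y v* C))\<^sup>2 \<le> ((a + sqrt (s / r) * c) * norm w)\<^sup>2"
      by (intro power_mono) auto
    then have "?m * norm (Y - X) * (norm (w v* A + y v* C))\<^sup>2
        \<le> ?m * norm (Y - X) * ((a + sqrt (s / r) * c) * norm w)\<^sup>2"
      by (intro mult_left_mono) auto
    moreover have "qf (F1 Y) w - qf (F1 X) w \<le> qf (Y - X) (w v* A + y v* C)"
      using F1_le[OF Y, of w y] unfolding y qf_diff_matrix by simp
    moreover have "?m * norm (Y - X) * ((a + sqrt (s / r) * c) * norm w)\<^sup>2 = K * norm (Y - X) * (norm w)\<^sup>2"
      by (simp add: K_def power_mult_distrib)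
    ultimately show ?thesis
      using qf_le_frobenius[of "Y - X" "w v* A + y v* C"] by linarith
  qed
  moreover have "0 \<le> K"
    by (simp add: K_def)
  ultimately show ?thesis
    using that by blast
qed

lemma continuous_on_F1: "continuous_on psd F1"
  unfolding continuous_on_iff
proof (intro ballI allI impI)
  fix X :: "real^'n^'n" and e :: real
  assume X: "X \<in> psd" and e: "0 < e"
  obtain K where K: "0 \<le> K" "\<And>Y Z w. Y \<in> psd \<Longrightarrow> Z \<in> psd \<Longrightarrow> norm Y \<le> norm X + 1 \<Longrightarrow>
      qf (F1 Z) w - qf (F1 Y) w \<le> K * norm (Z - Y) * (norm w)\<^sup>2"
    using F1_one_sided_lipschitz[of "norm X + 1"] by auto
  define m where "m = real CARD('n) * (real CARD('n) * (8 * K))"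
  have m: "0 \<le> m"
    using K(1) by (simp add: m_def)
  have "dist (F1 Y) (F1 X) < e" if Y: "Y \<in> psd" "dist Y X < min 1 (e / (m + 1))" for Y
  proof -
    \<comment> \<open>The radius 1 keeps \<open>Y\<close> in the ball for which \<open>K\<close> was
      chosen, so the one-sided estimate may be used with the two matrices exchanged.\<close>
    have "norm Y \<le> norm X + 1"
      using Y(2) norm_triangle_ineq2[of Y X] by (simp add: dist_norm)
    then have "\<bar>qf (F1 Y - F1 X) w\<bar> \<le> K * norm (Y - X) * (norm w)\<^sup>2" for w
      using K(2)[OF X Y(1), of w] K(2)[OF Y(1) X, of w] by (simp add: qf_diff_matrix norm_minus_commute)
    then have "norm (F1 Y - F1 X) \<le> real CARD('n) * (real CARD('n) * (8 * (K * norm (Y - X))))"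
      using K(1) by (intro norm_matrix_le_qf_bound) (simp_all add: transpose_diff transpose_F1 X Y(1))
    also have "\<dots> \<le> (m + 1) * dist Y X"
      by (simp add: m_def dist_norm algebra_simps)
    also have "\<dots> < e"
      using Y(2) m by (simp add: field_simps)
    finally show ?thesis
      by (simp add: dist_norm)
  qed
  then show "\<exists>d>0. \<forall>Y\<in>psd. dist Y X < d \<longrightarrow> dist (F1 Y) (F1 X) < e"
    using e m by (intro exI[of _ "min 1 (e / (m + 1))"]) auto
qed

section \<open>Uniform convergence to the fixed point\<close>

text \<open>A dead-beat choice of \<open>y\<close>, one that makes the argument of \<open>qf X\<close> vanish, removes the
  dependence on \<open>X\<close>; observability provides it for \<open>k = N\<close>.\<close>

lemma F1_iterate_le:
  "\<exists>B. \<forall>X\<in>psd. qf ((F1 ^^ k) X) w \<le> qf X (w v* matpow A k + (\<Sum>j<k. y j v* (C ** matpow A j))) + B"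
proof (induction k arbitrary: w)
  case 0
  show ?case
    by (rule exI[of _ 0]) simp
next
  case (Suc k)
  \<comment> \<open>The outermost \<open>f1\<close> uses \<open>y k\<close>; the remaining
    \<open>k\<close> applications multiply it by \<open>matpow A k\<close>, which produces the
    summand of index \<open>k\<close>.\<close>
  let ?w = "w v* A + y k v* C"
  obtain B where B: "\<forall>X\<in>psd. qf ((F1 ^^ k) X) ?w
      \<le> qf X (?w v* matpow A k + (\<Sum>j<k. y j v* (C ** matpow A j))) + B"
    using Suc by blast
  have "?w v* matpow A k + (\<Sum>j<k. y j v* (C ** matpow A j))
      = w v* matpow A (Suc k) + (\<Sum>j<Suc k. y j v* (C ** matpow A j))"
    by (simp only: vector_matrix_left_distrib vector_matrix_mul_assoc matpow_commute sum.lessThan_Suc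
        ac_simps)
  then have "qf ((F1 ^^ Suc k) X) w
      \<le> qf X (w v* matpow A (Suc k) + (\<Sum>j<Suc k. y j v* (C ** matpow A j))) + (B + qf Q w + qf R (y k))"
    if "X \<in> psd" for X
    using F1_le[OF F1_iterate_psd[OF that], of k w "y k"] B[rule_format, OF that]
    by (simp only: funpow.simps comp_apply)
  then show ?case
    by blast
qed

lemma F1_iterate_bounded:
  assumes "observable C A"
  obtains b where "0 \<le> b" "\<And>X. X \<in> psd \<Longrightarrow> norm ((F1 ^^ CARD('n)) X) \<le> b"
proof -
  let ?N = "CARD('n)"
  have "span (\<Union>k<?N. rows (C ** matpow A k)) = UNIV"
    using assms dim_eq_full[of "\<Union>k<?N. rows (C ** matpow A k)"] by (simp add: observable_def)
  have "\<exists>B. \<forall>X\<in>psd. qf ((F1 ^^ ?N) X) w \<le> B" for w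
  proof -
    obtain y where y: "- (w v* matpow A ?N) = (\<Sum>j<?N. y j v* (C ** matpow A j))"
      using span_rows_observability[of _ C A ?N] \<open>span _ = UNIV\<close> by blast
    show ?thesis
      using F1_iterate_le[of ?N w y] by (simp flip: y)
  qed
  then obtain B where B: "\<And>w X. X \<in> psd \<Longrightarrow> qf ((F1 ^^ ?N) X) w \<le> B w"
    by metis
  \<comment> \<open>The bounds \<open>B w\<close> are uniform in \<open>X\<close> but not in
    \<open>w\<close>; summing them over the finitely many test vectors of
    \<open>norm_matrix_le_qf\<close> gives one constant.\<close>
  define b where "b = (\<Sum>w\<in>range (\<lambda>(i, j). axis i 1 + axis j 1) \<union> range (\<lambda>i. axis i 1). \<bar>B w\<bar>)"
  have fin: "finite (range (\<lambda>(i :: 'n, j :: 'n). axis i 1 + axis j 1 :: real^'n) \<union> range (\<lambda>i :: 'n. axis i 1))"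
    by simp
  have b: "\<bar>B w\<bar> \<le> b"
    if "w \<in> range (\<lambda>(i :: 'n, j :: 'n). axis i 1 + axis j 1 :: real^'n) \<union> range (\<lambda>i :: 'n. axis i 1)" for w
    unfolding b_def using member_le_sum[OF that, of "\<lambda>w. \<bar>B w\<bar>"] fin by simp
  have bound: "\<bar>qf ((F1 ^^ ?N) X) w\<bar> \<le> b"
    if "X \<in> psd" "w \<in> range (\<lambda>(i, j). axis i 1 + axis j 1) \<union> range (\<lambda>i. axis i 1)" for X w
    using B[OF that(1), of w] qf_nonneg[OF F1_iterate_psd[OF that(1)], of ?N w] b[OF that(2)] by linarith
  have "norm ((F1 ^^ ?N) X) \<le> real ?N * (real ?N * (2 * b))" if "X \<in> psd" for X
  proof (rule norm_matrix_le_qf)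
    show "transpose ((F1 ^^ ?N) X) = (F1 ^^ ?N) X"
      using F1_iterate_psd[OF that] unfolding psd_iff by blast
    show "\<bar>qf ((F1 ^^ ?N) X) (axis i 1 + axis j 1)\<bar> \<le> b" for i j
      using bound[OF that] by blast
    show "\<bar>qf ((F1 ^^ ?N) X) (axis i 1)\<bar> \<le> b" for i
      using bound[OF that] by blast
  qed
  moreover have "0 \<le> b"
    by (simp add: b_def sum_nonneg)
  ultimately show ?thesis
    using that[of "real ?N * (real ?N * (2 * b))"] by simp
qed

lemma F1_pos_lower: "X \<in> psd \<Longrightarrow> qf Q w \<le> qf (F1 X) w"
  using F1_lower[of X X 0 w] qf_nonneg[of X] by simp

text \<open>After N steps every iterate lies between 0 and \<open>(1 + D) * P\<close> in the order
  of quadratic forms. Each further step shrinks both the lower and the upper gap to \<open>P\<close>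
  by the factor \<open>1 - q\<close>, with \<open>q\<close> and \<open>D\<close> independent of the
  initial state.\<close>

lemma F1_iterate_uniform_limit:
  assumes "observable C A" and P: "P \<in> psd" "F1 P = P"
    and W: "openin (top_of_set psd) W" "P \<in> W"
  obtains L where "\<And>k X. L \<le> k \<Longrightarrow> X \<in> psd \<Longrightarrow> (F1 ^^ k) X \<in> W"
proof -
  let ?N = "CARD('n)"
  let ?m = "real ?N * real ?N"
  obtain b where b: "0 \<le> b" "\<And>X. X \<in> psd \<Longrightarrow> norm ((F1 ^^ ?N) X) \<le> b"
    using F1_iterate_bounded[OF assms(1)] by blast
  obtain p where p: "0 < p" "\<And>v. p * (norm v)\<^sup>2 \<le> qf Q v"
    using pos_def_lower_bound[OF pos_def_Q] by blast
  have QP: "qf Q v \<le> qf P v" for v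
    using F1_pos_lower[OF P(1)] P(2) by simp
  define h where "h = ?m * norm P"
  have h: "0 \<le> h" "\<And>v. qf P v \<le> h * (norm v)\<^sup>2"
    unfolding h_def using qf_le_frobenius[of P] by auto
  \<comment> \<open>The denominator is chosen so that \<open>0 < q < 1\<close> and
    \<open>q * h \<le> p\<close>, which makes \<open>q\<close> times the form of \<open>P\<close> at
    most that of \<open>Q\<close>.\<close>
  define q where "q = p / (h + p + 1)"
  have q: "0 < q" "q < 1" and qh: "q * h \<le> p"
    using p(1) h(1) by (auto simp: q_def field_simps)
  have qP: "q * qf P v \<le> qf Q v" for v
  proof -
    have "q * qf P v \<le> (q * h) * (norm v)\<^sup>2"
      using h(2)[of v] q(1) by simp
    also have "\<dots> \<le> p * (norm v)\<^sup>2"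
      using qh by (intro mult_right_mono) auto
    finally show ?thesis
      using p(2)[of v] by simp
  qed
  \<comment> \<open>\<open>D\<close> measures the initial excess over \<open>P\<close>: the form
    after N steps is at most \<open>?m * b * (norm v)\<^sup>2\<close>, and
    \<open>p * (norm v)\<^sup>2\<close> is below the form of \<open>Q\<close>, hence below that of
    \<open>P\<close>.\<close>
  define D where "D = ?m * b / p"
  have D: "0 \<le> D"
    using b(1) p(1) by (simp add: D_def)
  have bounds: "(1 - (1 - q) ^ k) * qf P v \<le> qf ((F1 ^^ (k + ?N)) X) v
      \<and> qf ((F1 ^^ (k + ?N)) X) v \<le> (1 + D * (1 - q) ^ k) * qf P v" if X: "X \<in> psd" for k v X
  proof (induction k arbitrary: v)
    case 0
    let ?Y = "(F1 ^^ ?N) X"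
    have "qf ?Y v \<le> ?m * norm ?Y * (norm v)\<^sup>2"
      by (rule qf_le_frobenius)
    also have "\<dots> \<le> ?m * b * (norm v)\<^sup>2"
      using b(2)[OF X] by (intro mult_right_mono mult_left_mono) auto
    also have "\<dots> = D * (p * (norm v)\<^sup>2)"
      using p(1) by (simp add: D_def)
    also have "\<dots> \<le> D * qf P v"
      using D p(2)[of v] QP[of v] by (intro mult_left_mono) auto
    also have "\<dots> \<le> (1 + D) * qf P v"
      using qf_nonneg[OF P(1), of v] by (simp add: algebra_simps)
    finally show ?case
      using qf_nonneg[OF F1_iterate_psd[OF X], of ?N v] by simp
  next
    case (Suc k)
    let ?Y = "(F1 ^^ (k + ?N)) X" and ?e = "(1 - q) ^ k"
    have Y: "?Y \<in> psd"
      by (rule F1_iterate_psd[OF X])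
    have e: "0 \<le> ?e" "?e \<le> 1"
      using q by (auto intro: power_le_one)
    \<comment> \<open>The surplus in \<open>Q\<close> is at least \<open>?e * q\<close> times the
      form of \<open>P\<close>, so the lower gap \<open>?e\<close> becomes
      \<open>(1 - q) * ?e\<close>; the upper gap \<open>D * ?e\<close> shrinks in the same
      way.\<close>
    have "(1 - ?e) * qf P v + (1 - (1 - ?e)) * qf Q v \<le> qf (F1 ?Y) v"
      using F1_lower[OF P(1) Y, of "1 - ?e" v] Suc e P(2) by simp
    moreover have "?e * (q * qf P v) \<le> ?e * qf Q v"
      using e qP by (intro mult_left_mono) auto
    moreover have "qf (F1 ?Y) v \<le> (1 + D * ?e) * qf P v - (1 + D * ?e - 1) * qf Q v"
      using F1_upper[OF P(1) Y, of "1 + D * ?e" v] Suc e D P(2) by simp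
    moreover have "D * ?e * (q * qf P v) \<le> D * ?e * qf Q v"
      using e D qP by (intro mult_left_mono) auto
    ultimately show ?case
      by (simp add: algebra_simps)
  qed
  have close: "norm ((F1 ^^ (k + ?N)) X - P) \<le> real ?N * (real ?N * (8 * ((1 + D) * h * (1 - q) ^ k)))"
    if X: "X \<in> psd" for k X
  proof (rule norm_matrix_le_qf_bound)
    show "transpose ((F1 ^^ (k + ?N)) X - P) = (F1 ^^ (k + ?N)) X - P"
      using F1_iterate_psd[OF X] P(1) unfolding transpose_diff psd_iff by metis
    have e: "0 \<le> (1 - q) ^ k"
      using q by simp
    show "0 \<le> (1 + D) * h * (1 - q) ^ k"
      using D h(1) e by simp
    fix v
    have "\<bar>qf ((F1 ^^ (k + ?N)) X - P) v\<bar> \<le> (1 + D) * (1 - q) ^ k * qf P v"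
    proof -
      have "0 \<le> (1 - q) ^ k * qf P v" "0 \<le> D * ((1 - q) ^ k * qf P v)"
        using e D qf_nonneg[OF P(1), of v] by simp_all
      then show ?thesis
        using bounds[OF X, of k v] unfolding qf_diff_matrix by (simp add: algebra_simps abs_le_iff)
    qed
    also have "\<dots> \<le> (1 + D) * (1 - q) ^ k * (h * (norm v)\<^sup>2)"
      using h(2)[of v] D e by (intro mult_left_mono) auto
    finally show "\<bar>qf ((F1 ^^ (k + ?N)) X - P) v\<bar> \<le> (1 + D) * h * (1 - q) ^ k * (norm v)\<^sup>2"
      by (simp add: algebra_simps)
  qed
  obtain e where e: "0 < e" "\<And>Y. Y \<in> psd \<Longrightarrow> dist Y P < e \<Longrightarrow> Y \<in> W"
    using W unfolding openin_euclidean_subtopology_iff by blast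
  have "(\<lambda>k. real ?N * (real ?N * (8 * ((1 + D) * h * (1 - q) ^ k)))) \<longlonglongrightarrow> real ?N * (real ?N * (8 * ((1 + D) * h * 0)))"
    using q by (intro tendsto_intros LIMSEQ_realpow_zero) auto
  then have "\<forall>\<^sub>F k in sequentially. real ?N * (real ?N * (8 * ((1 + D) * h * (1 - q) ^ k))) < e"
    using e(1) by (intro order_tendstoD(2)) auto
  then obtain L where L: "\<And>k. L \<le> k \<Longrightarrow> real ?N * (real ?N * (8 * ((1 + D) * h * (1 - q) ^ k))) < e"
    unfolding eventually_sequentially by blast
  show ?thesis
  proof
    fix k and X :: "real^'n^'n"
    assume "L + ?N \<le> k" and X: "X \<in> psd"
    then have "dist ((F1 ^^ (k - ?N + ?N)) X) P < e"
      using close[OF X, of "k - ?N"] L[of "k - ?N"] unfolding dist_norm by linarith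
    moreover have "k - ?N + ?N = k"
      using \<open>L + ?N \<le> k\<close> by simp
    ultimately show "(F1 ^^ k) X \<in> W"
      using e(2) F1_iterate_psd[OF X] by metis
  qed
qed

end

section \<open>Strings\<close>

lemma num_f0_eq: "num_f0 (bs, P) = length (filter Not bs)"
  by (simp add: num_f0_def length_filter_conv_card)

lemma foldr_replicate_funpow: "foldr f (replicate k x) = f x ^^ k"
  by (induction k) auto

locale stationary_riccati = riccati A Q C R
  for A Q :: "real^'n^'n" and C :: "real^'n^'m" and R :: "real^'m^'m" +
  fixes P :: "real^'n^'n"
  assumes observable: "observable C A" and P_psd: "P \<in> psd" and F1_P: "F1 P = P"
begin

abbreviation F :: "bool \<Rightarrow> real^'n^'n \<Rightarrow> real^'n^'n" where "F \<equiv> f_idx A C Q R"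

lemma F_psd: "X \<in> psd \<Longrightarrow> F b X \<in> psd"
  by (simp add: f_idx_def F0_psd F1_psd)

lemma continuous_on_F: "continuous_on psd (F b)"
  by (simp add: f_idx_def continuous_on_F0 continuous_on_F1)

lemma openin_preimage_F:
  "openin (top_of_set psd) U \<Longrightarrow> openin (top_of_set psd) {X \<in> psd. F b X \<in> U}"
  using continuous_openin_preimage[OF continuous_on_F, of b psd U] F_psd
  by (auto simp: vimage_def Int_def)

lemma closedin_preimage_F:
  "closedin (top_of_set psd) U \<Longrightarrow> closedin (top_of_set psd) {X \<in> psd. F b X \<in> U}"
  using continuous_closedin_preimage_gen[OF continuous_on_F, of b psd U] F_psd
  by (auto simp: vimage_def Int_def)

lemma F1_iterate_preimage_Suc:
  "{X \<in> psd. (F1 ^^ Suc k) X \<in> U} = {X \<in> psd. F True X \<in> {Y \<in> psd. (F1 ^^ k) Y \<in> U}}"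
  using F1_psd by (auto simp: f_idx_def funpow_swap1)

lemma closedin_preimage_F1_iterate:
  "closedin (top_of_set psd) U \<Longrightarrow> closedin (top_of_set psd) {X \<in> psd. (F1 ^^ k) X \<in> U}"
proof (induction k)
  case 0
  then show ?case
    using closedin_imp_subset[OF 0] by (simp add: Int_absorb1 flip: Int_def Collect_conj_eq)
next
  case (Suc k)
  show ?case
    unfolding F1_iterate_preimage_Suc by (rule closedin_preimage_F[OF Suc.IH[OF Suc.prems]])
qed

lemma foldr_F_psd: "X \<in> psd \<Longrightarrow> foldr F bs X \<in> psd"
  by (induction bs) (auto intro: F_psd)

lemma foldr_preimage_Cons:
  "{X \<in> psd. foldr F (b # bs) X \<in> U} = {X \<in> psd. foldr F bs X \<in> {Y \<in> psd. F b Y \<in> U}}"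
  by (auto intro: foldr_F_psd)

lemma openin_preimage_foldr_F:
  "openin (top_of_set psd) U \<Longrightarrow> openin (top_of_set psd) {X \<in> psd. foldr F bs X \<in> U}"
proof (induction bs arbitrary: U)
  case Nil
  then show ?case
    using openin_imp_subset[OF Nil] by (simp add: Int_absorb1 flip: Int_def Collect_conj_eq)
next
  case (Cons b bs)
  show ?case
    unfolding foldr_preimage_Cons by (rule Cons.IH[OF openin_preimage_F[OF Cons.prems]])
qed

text \<open>These are the sets \<open>K\<^sub>n\<close>. The strict inequality makes
  \<open>level 0\<close> empty, so that inductions can start from a trivial case.\<close>

definition level :: "nat \<Rightarrow> (real^'n^'n) set" where
  "level n = {foldr F bs P | bs. length (filter Not bs) < n}"

lemma level_0 [simp]: "level 0 = {}"
  by (simp add: level_def)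

text \<open>Split a string at its outermost \<open>f0\<close>: only letters \<open>f1\<close>
  precede it, and the rest has one \<open>f0\<close> fewer. Without any \<open>f0\<close> the value
  is \<open>P\<close>, the fixed point.\<close>

lemma level_Suc: "level (Suc n) = insert P (\<Union>k. (\<lambda>X. (F1 ^^ k) (F0 X)) ` level n)"
proof (intro equalityI subsetI)
  fix X assume "X \<in> level (Suc n)"
  then obtain bs where "X = foldr F bs P" "length (filter Not bs) < Suc n"
    by (auto simp: level_def)
  then show "X \<in> insert P (\<Union>k. (\<lambda>X. (F1 ^^ k) (F0 X)) ` level n)"
  proof (induction bs arbitrary: X)
    case (Cons b bs)
    show ?case
    proof (cases b)
      case True
      then have "X = F1 (foldr F bs P)"
        using Cons.prems by (simp add: f_idx_def[of _ _ _ _ True])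
      moreover have "foldr F bs P \<in> insert P (\<Union>k. (\<lambda>X. (F1 ^^ k) (F0 X)) ` level n)"
        using Cons True by simp
      ultimately consider "X = P" | k Y where "Y \<in> level n" "X = F1 ((F1 ^^ k) (F0 Y))"
        using F1_P by auto
      then show ?thesis
      proof cases
        case (2 k Y)
        then have "X = (F1 ^^ Suc k) (F0 Y)" by simp
        then show ?thesis using 2(1) by blast
      qed simp
    next
      case False
      then have "X = (F1 ^^ 0) (F0 (foldr F bs P))" "foldr F bs P \<in> level n"
        using Cons.prems by (auto simp: f_idx_def[of _ _ _ _ False] level_def)
      then show ?thesis by blast
    qed
  qed simp
next
  fix X assume "X \<in> insert P (\<Union>k. (\<lambda>X. (F1 ^^ k) (F0 X)) ` level n)"
  then consider "X = P" | k bs where "length (filter Not bs) < n" "X = (F1 ^^ k) (F0 (foldr F bs P))"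
    by (auto simp: level_def)
  then show "X \<in> level (Suc n)"
  proof cases
    case 1
    then show ?thesis
      unfolding level_def by (auto intro: exI[of _ "[]"])
  next
    case (2 k bs)
    then have "X = foldr F (replicate k True @ False # bs) P"
      by (simp add: foldr_replicate_funpow f_idx_def)
    moreover have "length (filter Not (replicate k True @ False # bs)) < Suc n"
      using 2(1) by simp
    ultimately show ?thesis
      unfolding level_def by blast
  qed
qed

section \<open>Compactness of the sets of string values\<close>

lemma level_subset_psd: "level n \<subseteq> psd"
  using foldr_F_psd[OF P_psd] by (auto simp: level_def)

lemma compact_image_F1_iterate: "compact S \<Longrightarrow> S \<subseteq> psd \<Longrightarrow> compact ((F1 ^^ k) ` S)"
proof (induction k)
  case (Suc k)
  have "(F1 ^^ k) ` S \<subseteq> psd"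
    using Suc.prems(2) F1_iterate_psd by blast
  then have "compact (F1 ` (F1 ^^ k) ` S)"
    using compact_continuous_image[OF continuous_on_subset[OF continuous_on_F1]] Suc by blast
  then show ?case
    by (simp add: image_image)
qed simp

text \<open>In an open cover, a member containing \<open>P\<close> absorbs all images under iterates
  of order at least some \<open>L\<close>, by uniform convergence; the finitely many earlier images
  are compact by induction and continuity.\<close>

lemma compact_level: "compact (level n)"
proof (induction n)
  case (Suc n)
  define S where "S = F0 ` level n"
  have S: "compact S" "S \<subseteq> psd"
    using compact_continuous_image[OF continuous_on_F0 Suc] level_subset_psd[of n] F0_psd
    by (auto simp: S_def)
  have level: "level (Suc n) = insert P (\<Union>k. (F1 ^^ k) ` S)"
    by (simp add: level_Suc S_def image_image)
  show ?case
  unfolding compact_eq_Heine_Borel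
  proof (intro allI impI, elim conjE)
    fix \<C> :: "(real^'n^'n) set set"
    assume op: "\<forall>U\<in>\<C>. open U" and cover: "level (Suc n) \<subseteq> \<Union>\<C>"
    obtain W where W: "W \<in> \<C>" "P \<in> W"
      using cover level by blast
    have "openin (top_of_set psd) (psd \<inter> W)"
      using op W(1) by blast
    then obtain L where L: "\<And>k X. L \<le> k \<Longrightarrow> X \<in> psd \<Longrightarrow> (F1 ^^ k) X \<in> psd \<inter> W"
      using F1_iterate_uniform_limit[OF observable P_psd F1_P] W(2) P_psd by blast
    have "compact (\<Union>k<L. (F1 ^^ k) ` S)"
      using S by (intro compact_UN compact_image_F1_iterate) auto
    moreover have "(\<Union>k<L. (F1 ^^ k) ` S) \<subseteq> \<Union>\<C>"
      using cover level by blast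
    ultimately obtain \<D> where D: "\<D> \<subseteq> \<C>" "finite \<D>" "(\<Union>k<L. (F1 ^^ k) ` S) \<subseteq> \<Union>\<D>"
      using op by (metis compactE)
    have "level (Suc n) \<subseteq> \<Union>(insert W \<D>)"
    proof
      fix X assume "X \<in> level (Suc n)"
      then consider "X = P" | k Y where "Y \<in> S" "X = (F1 ^^ k) Y"
        unfolding level by blast
      then show "X \<in> \<Union>(insert W \<D>)"
      proof cases
        case (2 k Y)
        then show ?thesis
          using D(3) L[of k Y] S(2) by (cases "k < L") auto
      qed (use W in auto)
    qed
    then show "\<exists>\<D>\<subseteq>\<C>. finite \<D> \<and> level (Suc n) \<subseteq> \<Union>\<D>"
      using D(1,2) W(1) by (intro exI[of _ "insert W \<D>"]) auto
  qed
qed simp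

section \<open>Level sets of the rate function\<close>

lemma rate_eq: "rate A C Q R P X = (INF bs\<in>{bs. foldr F bs P = X}. ereal (real (length (filter Not bs))))"
proof -
  have "strings_of_value A C Q R P X = (\<lambda>bs. (bs, P)) ` {bs. foldr F bs P = X}"
    by (auto simp: strings_of_value_def strings_def numerical_value_def)
  then show ?thesis
    by (simp add: rate_def num_f0_eq image_image)
qed

lemma rate_nonneg: "0 \<le> rate A C Q R P X"
  unfolding rate_eq by (rule INF_greatest) simp

lemma rate_less_iff: "rate A C Q R P X < ereal (real n) \<longleftrightarrow> X \<in> level n"
  unfolding rate_eq INF_less_iff level_def by auto

text \<open>Counts of letters are integers, so \<open>a\<close> may be rounded down; the
  \<open>Suc\<close> turns the strict inequality in \<open>level\<close> into a weak one.\<close>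

lemma rate_le_iff:
  assumes "0 \<le> a"
  shows "rate A C Q R P X \<le> ereal a \<longleftrightarrow> X \<in> level (Suc (nat \<lfloor>a\<rfloor>))"
proof
  assume "rate A C Q R P X \<le> ereal a"
  also have "ereal a < ereal (real (Suc (nat \<lfloor>a\<rfloor>)))"
    using assms by (simp, linarith)
  finally show "X \<in> level (Suc (nat \<lfloor>a\<rfloor>))"
    by (simp only: rate_less_iff)
next
  assume "X \<in> level (Suc (nat \<lfloor>a\<rfloor>))"
  then obtain bs where "X = foldr F bs P" "length (filter Not bs) \<le> nat \<lfloor>a\<rfloor>"
    by (auto simp: level_def)
  moreover from this(2) have "real (length (filter Not bs)) \<le> a"
    using assms by linarith
  ultimately show "rate A C Q R P X \<le> ereal a"
    unfolding rate_eq by (intro INF_lower2[of bs]) auto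
qed

lemma sublevel_eq: "0 \<le> a \<Longrightarrow> {X \<in> psd. rate A C Q R P X \<le> ereal a} = level (Suc (nat \<lfloor>a\<rfloor>))"
  using level_subset_psd by (auto simp: rate_le_iff)

lemma compactin_sublevel:
  "0 \<le> a \<Longrightarrow> compactin psd_topology {X \<in> psd. rate A C Q R P X \<le> ereal a}"
  unfolding sublevel_eq psd_topology_eq compactin_subtopology
  using compact_level level_subset_psd by simp

text \<open>For \<open>y \<ge> 0\<close> the sublevel set is compact, hence closed, and its
  complement is the neighbourhood sought. A negative \<open>y\<close> lies below the rate
  everywhere.\<close>

lemma lower_semicontinuous_rate: "lower_semicontinuous psd_topology (rate A C Q R P)"
  unfolding lower_semicontinuous_def psd_topology_eq
proof (intro ballI)
  fix X assume "X \<in> topspace (top_of_set (psd :: (real^'n^'n) set))"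
  then have X: "X \<in> psd" by simp
  show "rate A C Q R P X \<le> Liminf (atin (top_of_set psd) X) (rate A C Q R P)"
    unfolding le_Liminf_iff
  proof (intro allI impI)
    fix y assume y: "y < rate A C Q R P X"
    show "\<forall>\<^sub>F Y in atin (top_of_set psd) X. y < rate A C Q R P Y"
    proof (cases "0 \<le> y")
      case True
      then obtain a where a: "y = ereal a" "0 \<le> a"
        using y by (cases y) auto
      have "closed (level (Suc (nat \<lfloor>a\<rfloor>)))"
        by (rule compact_imp_closed[OF compact_level])
      then have "openin (top_of_set psd) (psd - level (Suc (nat \<lfloor>a\<rfloor>)))"
        by (metis Diff_eq open_Compl openin_open_Int)
      moreover have "X \<in> psd - level (Suc (nat \<lfloor>a\<rfloor>))"
        using X y a by (simp flip: rate_le_iff)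
      moreover have "\<forall>Y\<in>psd - level (Suc (nat \<lfloor>a\<rfloor>)). y < rate A C Q R P Y"
        using a by (auto simp flip: rate_le_iff)
      ultimately show ?thesis
        unfolding eventually_atin by blast
    next
      case False
      then have "y < rate A C Q R P Y" for Y
        using rate_nonneg[of Y] by (meson le_less_trans not_le less_le_trans)
      then show ?thesis by simp
    qed
  qed
qed

section \<open>Invariant distributions\<close>

lemma measurable_F: "F b \<in> psd_borel \<rightarrow>\<^sub>M psd_borel"
proof (rule measurable_sigma_sets[OF sets_psd_borel])
  show "{U. openin (top_of_set psd) U} \<subseteq> Pow (psd :: (real^'n^'n) set)"
    using openin_imp_subset by auto
  show "F b \<in> space psd_borel \<rightarrow> psd"
    using F_psd by simp
  fix U assume "U \<in> {U. openin (top_of_set (psd :: (real^'n^'n) set)) U}"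
  then have "openin (top_of_set psd) {X \<in> psd. F b X \<in> U}"
    by (simp add: openin_preimage_F)
  moreover have "F b -` U \<inter> space psd_borel = {X \<in> psd. F b X \<in> U}"
    by auto
  ultimately show "F b -` U \<inter> space psd_borel \<in> sets psd_borel"
    by (simp add: sets_psd_borel sigma_sets.Basic)
qed

lemma openin_sets: "openin (top_of_set psd) U \<Longrightarrow> U \<in> sets (psd_borel :: (real^'n^'n) measure)"
  by (simp add: sets_psd_borel sigma_sets.Basic)

lemma closedin_sets:
  assumes "closedin (top_of_set psd) U"
  shows "U \<in> sets (psd_borel :: (real^'n^'n) measure)"
proof -
  have "psd - U \<in> sets (psd_borel :: (real^'n^'n) measure)"
    using assms by (auto intro!: openin_sets simp: closedin_def)
  then have "space psd_borel - (psd - U) \<in> sets (psd_borel :: (real^'n^'n) measure)"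
    by (rule sets.compl_sets)
  moreover have "psd - (psd - U) = U"
    using closedin_imp_subset[OF assms] by blast
  ultimately show ?thesis by simp
qed

lemma preimage_F_sets: "B \<in> sets psd_borel \<Longrightarrow> {X \<in> psd. F b X \<in> B} \<in> sets psd_borel"
  using measurable_sets[OF measurable_F, of B b] by (simp add: vimage_def Int_def conj_commute)

lemma invariant_prob_space: "invariant_distribution A C Q R g M \<Longrightarrow> prob_space M"
  by (simp add: invariant_distribution_def)

lemma emeasure_transition_kernel:
  assumes "0 < g" "g < 1" "X \<in> psd" "B \<in> sets psd_borel"
  shows "emeasure (transition_kernel A C Q R g X) B
    = indicator {X \<in> psd. F True X \<in> B} X * ennreal g + indicator {X \<in> psd. F False X \<in> B} X * ennreal (1 - g)"
proof -
  let ?p = "measure_pmf (bernoulli_pmf g)"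
  have m: "(\<lambda>b. F b X) \<in> ?p \<rightarrow>\<^sub>M psd_borel"
    using F_psd[OF assms(3)] by simp
  have "emeasure (transition_kernel A C Q R g X) B = (\<integral>\<^sup>+ Y. indicator B Y \<partial>transition_kernel A C Q R g X)"
    using assms(4) by (simp add: transition_kernel_def)
  also have "\<dots> = (\<integral>\<^sup>+ b. indicator B (F b X) \<partial>?p)"
    unfolding transition_kernel_def using assms(4) by (intro nn_integral_distr m) simp
  also have "\<dots> = indicator B (F True X) * ennreal g + indicator B (F False X) * ennreal (1 - g)"
    using assms(1,2) by (subst nn_integral_bernoulli_pmf) auto
  finally show ?thesis
    using assms(3) by (simp add: indicator_def)
qed

text \<open>Stationarity conditioned on the last map applied. Both mass bounds come from unrolling
  this identity.\<close>

lemma invariant_measure_eq: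
  assumes inv: "invariant_distribution A C Q R g M" and g: "0 < g" "g < 1" and B: "B \<in> sets psd_borel"
  shows "measure M B = g * measure M {X \<in> psd. F True X \<in> B} + (1 - g) * measure M {X \<in> psd. F False X \<in> B}"
proof -
  interpret prob_space M
    by (rule invariant_prob_space[OF inv])
  have sets: "sets M = sets psd_borel"
    using inv by (simp add: invariant_distribution_def)
  have space: "space M = psd"
    using sets_eq_imp_space_eq[OF sets] by simp
  have [measurable]: "{X \<in> psd. F b X \<in> B} \<in> sets M" for b
    unfolding sets by (rule preimage_F_sets[OF B])
  have "emeasure M B = (\<integral>\<^sup>+ X. emeasure (transition_kernel A C Q R g X) B \<partial>M)"
    using inv B by (simp add: invariant_distribution_def)
  also have "\<dots> = (\<integral>\<^sup>+ X. indicator {X \<in> psd. F True X \<in> B} X * ennreal g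
      + indicator {X \<in> psd. F False X \<in> B} X * ennreal (1 - g) \<partial>M)"
    by (intro nn_integral_cong emeasure_transition_kernel g B) (simp add: space)
  also have "\<dots> = emeasure M {X \<in> psd. F True X \<in> B} * ennreal g
      + emeasure M {X \<in> psd. F False X \<in> B} * ennreal (1 - g)"
    by (subst nn_integral_add) (simp_all add: nn_integral_multc)
  finally have "ennreal (measure M B) = ennreal (measure M {X \<in> psd. F True X \<in> B} * g
      + measure M {X \<in> psd. F False X \<in> B} * (1 - g))"
    using g by (simp add: emeasure_eq_measure ennreal_mult' ennreal_plus)
  then show ?thesis
    using g by (subst (asm) ennreal_inj) (auto simp: mult.commute)
qed

section \<open>Mass bounds in powers of \<open>1 - g\<close>\<close>

lemma invariant_upper:
  assumes "closedin (top_of_set psd) E" "E \<inter> level n = {}"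
  shows "\<exists>K>0. \<forall>g M. 0 < g \<longrightarrow> g < 1 \<longrightarrow> invariant_distribution A C Q R g M \<longrightarrow> measure M E \<le> K * (1 - g) ^ n"
  using assms
proof (induction n arbitrary: E)
  case 0
  show ?case
    by (rule exI[of _ 1]) (auto intro: prob_space.prob_le_1 invariant_prob_space)
next
  case (Suc n)
  have "openin (top_of_set psd) (psd - E)"
    using Suc.prems(1) by (simp add: closedin_def)
  moreover have "P \<in> psd - E"
    using Suc.prems(2) P_psd by (auto simp: level_Suc)
  ultimately obtain L where L: "\<And>k X. L \<le> k \<Longrightarrow> X \<in> psd \<Longrightarrow> (F1 ^^ k) X \<in> psd - E"
    using F1_iterate_uniform_limit[OF observable P_psd F1_P] by blast
  \<comment> \<open>Stationarity expresses the mass of \<open>G k\<close> through that of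
    \<open>G (Suc k)\<close>, when the last letter is \<open>f1\<close>, and that of
    \<open>H k\<close>, when it is \<open>f0\<close>. The chain starts at \<open>G 0 = E\<close> and
    stops at the empty set \<open>G L\<close>.\<close>
  define G where "G = (\<lambda>k. {X \<in> psd. (F1 ^^ k) X \<in> E})"
  define H where "H = (\<lambda>k. {X \<in> psd. F False X \<in> G k})"
  have G: "closedin (top_of_set psd) (G k)" for k
    unfolding G_def by (rule closedin_preimage_F1_iterate[OF Suc.prems(1)])
  have "\<exists>K>0. \<forall>g M. 0 < g \<longrightarrow> g < 1 \<longrightarrow> invariant_distribution A C Q R g M \<longrightarrow> measure M (H k) \<le> K * (1 - g) ^ n" for k
  proof (rule Suc.IH)
    show "closedin (top_of_set psd) (H k)"
      unfolding H_def by (rule closedin_preimage_F[OF G])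
    \<comment> \<open>A point of \<open>level n\<close> in \<open>H k\<close> would be carried by
      \<open>f0\<close> and \<open>k\<close> letters \<open>f1\<close> to a point of
      \<open>E\<close> in \<open>level (Suc n)\<close>.\<close>
    show "H k \<inter> level n = {}"
      using Suc.prems(2) by (auto simp: H_def G_def level_Suc f_idx_def)
  qed
  then obtain K where K: "\<And>k. 0 < K k"
    "\<And>k g M. 0 < g \<Longrightarrow> g < 1 \<Longrightarrow> invariant_distribution A C Q R g M \<Longrightarrow> measure M (H k) \<le> K k * (1 - g) ^ n"
    by metis
  \<comment> \<open>The added 1 keeps the constant positive when the sum is empty; its logarithm is
    taken later.\<close>
  have "measure M E \<le> (1 + (\<Sum>k<L. K k)) * (1 - g) ^ Suc n"
    if g: "0 < g" "g < 1" and inv: "invariant_distribution A C Q R g M" for g M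
  proof -
    have step: "measure M (G k) \<le> measure M (G (Suc k)) + K k * (1 - g) ^ Suc n" for k
    proof -
      have "measure M (G k) = g * measure M (G (Suc k)) + (1 - g) * measure M (H k)"
        using invariant_measure_eq[OF inv g closedin_sets[OF G], of k]
        unfolding H_def G_def F1_iterate_preimage_Suc .
      moreover have "g * measure M (G (Suc k)) \<le> 1 * measure M (G (Suc k))"
        using g by (intro mult_right_mono) auto
      moreover have "(1 - g) * measure M (H k) \<le> (1 - g) * (K k * (1 - g) ^ n)"
        using g K(2)[OF g inv, of k] by (intro mult_left_mono) auto
      ultimately show ?thesis
        by (simp add: algebra_simps)
    qed
    have "measure M (G 0) \<le> measure M (G m) + (\<Sum>k<m. K k * (1 - g) ^ Suc n)" for m
    proof (induction m)
      case (Suc m)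
      then show ?case
        using step[of m] unfolding sum.lessThan_Suc by linarith
    qed simp
    moreover have "G L = {}"
      using L[of L] by (auto simp: G_def)
    moreover have "G 0 = E"
      using closedin_imp_subset[OF Suc.prems(1)] by (auto simp: G_def)
    ultimately have "measure M E \<le> (\<Sum>k<L. K k * (1 - g) ^ Suc n)"
      by (metis add_0 measure_empty)
    also have "\<dots> = (\<Sum>k<L. K k) * (1 - g) ^ Suc n"
      by (simp add: sum_distrib_right)
    also have "\<dots> \<le> (1 + (\<Sum>k<L. K k)) * (1 - g) ^ Suc n"
      using g by (intro mult_right_mono) auto
    finally show ?thesis .
  qed
  moreover have "0 < 1 + (\<Sum>k<L. K k)"
    using K(1) by (intro add_pos_nonneg sum_nonneg) (auto intro: less_imp_le)
  ultimately show ?case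
    by blast
qed

text \<open>Keep in each step of stationarity only the branch of the prescribed letter. A letter
  \<open>f0\<close> has probability \<open>1 - g\<close>, which is weakened to
  \<open>g * (1 - g)\<close> so that the exponent of \<open>g\<close> is simply the length.\<close>

lemma invariant_foldr_lower:
  assumes g: "0 < g" "g < 1" and inv: "invariant_distribution A C Q R g M"
    and U: "openin (top_of_set psd) U"
  shows "g ^ length bs * (1 - g) ^ length (filter Not bs) * measure M {X \<in> psd. foldr F bs X \<in> U} \<le> measure M U"
  using U
proof (induction bs arbitrary: U)
  case Nil
  then show ?case
    using openin_imp_subset[OF Nil] by (simp add: Int_absorb1 flip: Int_def Collect_conj_eq)
next
  case (Cons b bs)
  let ?V = "\<lambda>b. {X \<in> psd. F b X \<in> U}"
  let ?w = "g ^ length bs * (1 - g) ^ length (filter Not bs) * measure M {X \<in> psd. foldr F bs X \<in> ?V b}"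
  have "g * (1 - g) ^ (if b then 0 else 1) * ?w \<le> (if b then g else 1 - g) * ?w"
    using g by (intro mult_right_mono) (auto simp: mult_le_cancel_right1)
  also have "\<dots> \<le> (if b then g else 1 - g) * measure M (?V b)"
    using g Cons.IH[OF openin_preimage_F[OF Cons.prems]] by (intro mult_left_mono) auto
  also have "\<dots> \<le> measure M U"
    using g invariant_measure_eq[OF inv g openin_sets[OF Cons.prems]] by simp
  finally show ?case
    unfolding foldr_preimage_Cons by (cases b) (simp_all add: ac_simps)
qed

text \<open>The appended letters \<open>f1\<close> act first and erase the initial state, so the
  preimage of \<open>U\<close> under the longer string is the whole space, of mass 1. They add no
  \<open>f0\<close>, and \<open>g \<ge> 1 / 2\<close> bounds the power of \<open>g\<close> below by
  a constant.\<close>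

lemma invariant_lower:
  assumes U: "openin (top_of_set psd) U" "foldr F bs P \<in> U"
  shows "\<exists>K>0. \<forall>g M. 1 / 2 \<le> g \<longrightarrow> g < 1 \<longrightarrow> invariant_distribution A C Q R g M
    \<longrightarrow> K * (1 - g) ^ length (filter Not bs) \<le> measure M U"
proof -
  have "P \<in> {X \<in> psd. foldr F bs X \<in> U}"
    using U(2) P_psd by simp
  then obtain L where L: "\<And>k X. L \<le> k \<Longrightarrow> X \<in> psd \<Longrightarrow> (F1 ^^ k) X \<in> {X \<in> psd. foldr F bs X \<in> U}"
    using F1_iterate_uniform_limit[OF observable P_psd F1_P openin_preimage_foldr_F[OF U(1)]] by blast
  let ?bs = "bs @ replicate L True"
  have "foldr F ?bs X \<in> U" if "X \<in> psd" for X
  proof -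
    have "F True = F1"
      by (simp add: f_idx_def)
    then show ?thesis
      using L[OF order_refl that] by (simp add: foldr_replicate_funpow)
  qed
  then have all: "{X \<in> psd. foldr F ?bs X \<in> U} = psd"
    by auto
  have "(1 / 2) ^ length ?bs * (1 - g) ^ length (filter Not bs) \<le> measure M U"
    if g: "1 / 2 \<le> g" "g < 1" and inv: "invariant_distribution A C Q R g M" for g M
  proof -
    interpret prob_space M
      by (rule invariant_prob_space[OF inv])
    have "space M = psd"
      using inv sets_eq_imp_space_eq[of M psd_borel] by (simp add: invariant_distribution_def)
    then have "measure M psd = 1"
      using prob_space by simp
    moreover have "0 < g"
      using g by simp
    ultimately have "g ^ length ?bs * (1 - g) ^ length (filter Not ?bs) \<le> measure M U"
      using invariant_foldr_lower[OF _ g(2) inv U(1), of ?bs] unfolding all by simp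
    moreover have "(1 / 2) ^ length ?bs * (1 - g) ^ length (filter Not bs) \<le> g ^ length ?bs * (1 - g) ^ length (filter Not bs)"
      using g by (intro mult_right_mono power_mono) auto
    ultimately show ?thesis
      by simp
  qed
  then show ?thesis
    by (intro exI[of _ "(1 / 2) ^ length ?bs"]) simp
qed

end

section \<open>Asymptotics of the logarithms\<close>

lemma ln_ext_mono: "0 \<le> x \<Longrightarrow> x \<le> y \<Longrightarrow> ln_ext x \<le> ln_ext y"
  by (auto simp: ln_ext_def)

lemma scaled_ln_ext_mono:
  assumes "0 < g" "g < 1" "0 \<le> x" "x \<le> y"
  shows "ereal (- (1 / ln (1 - g))) * ln_ext x \<le> ereal (- (1 / ln (1 - g))) * ln_ext y"
  using assms by (intro ereal_mult_left_mono ln_ext_mono) (auto simp: divide_nonneg_neg divide_nonpos_nonpos)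

text \<open>For \<open>g\<close> in (0, 1) the expression is \<open>- ln K / ln (1 - g) - n\<close>,
  and the first term vanishes in the limit. Hence mass bounds up to a constant factor
  suffice.\<close>

lemma scaled_ln_ext_limit:
  assumes "0 < K"
  shows "((\<lambda>g. ereal (- (1 / ln (1 - g))) * ln_ext (K * (1 - g) ^ n)) \<longlongrightarrow> ereal (- real n)) (at_left (1::real))"
proof -
  have "((\<lambda>g::real. 1 / ln (1 - g)) \<longlongrightarrow> 0) (at_left 1)"
    by real_asymp
  then have "((\<lambda>g::real. - (1 / ln (1 - g)) * ln K - real n) \<longlongrightarrow> - 0 * ln K - real n) (at_left 1)"
    by (intro tendsto_intros)
  then have "((\<lambda>g::real. ereal (- (1 / ln (1 - g)) * ln K - real n)) \<longlongrightarrow> ereal (- real n)) (at_left 1)"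
    by simp
  moreover have "\<forall>\<^sub>F g in at_left (1::real). ereal (- (1 / ln (1 - g)) * ln K - real n)
      = ereal (- (1 / ln (1 - g))) * ln_ext (K * (1 - g) ^ n)"
  proof (rule eventually_mono)
    show "\<forall>\<^sub>F g in at_left (1::real). g \<in> {0<..<1}"
      by (rule eventually_at_leftI[of 0]) auto
    fix g :: real assume g: "g \<in> {0<..<1}"
    then have "ln (1 - g) < 0" "K * (1 - g) ^ n \<noteq> 0"
      using assms by auto
    moreover have "ln (K * (1 - g) ^ n) = ln K + real n * ln (1 - g)"
      using g assms by (simp add: ln_mult ln_realpow)
    ultimately show "ereal (- (1 / ln (1 - g)) * ln K - real n)
        = ereal (- (1 / ln (1 - g))) * ln_ext (K * (1 - g) ^ n)"
      by (simp add: ln_ext_def field_simps)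
  qed
  ultimately show ?thesis
    by (rule Lim_transform_eventually)
qed

section \<open>Lower bound on open sets and upper bound on closed sets\<close>

theorem mainTheorem4:
  fixes A Q :: "real^'n^'n" and C :: "real^'n^'m" and R :: "real^'m^'m"
    and Pstar :: "real^'n^'n" and \<mu> :: "real \<Rightarrow> (real^'n^'n) measure"
  assumes "observable C A" and "pos_def Q" and "pos_def R"
    and "Pstar \<in> psd" and "f1 A C Q R Pstar = Pstar"
    and "\<And>g. 0 < g \<Longrightarrow> g < 1 \<Longrightarrow> invariant_distribution A C Q R g (\<mu> g)"
  shows "lower_semicontinuous psd_topology (rate A C Q R Pstar)
    \<and> (\<forall>a::real. 0 \<le> a \<longrightarrow> compactin psd_topology {X \<in> psd. rate A C Q R Pstar X \<le> ereal a})
    \<and> (\<forall>U. openin psd_topology U \<longrightarrow>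
         Liminf (at_left 1) (\<lambda>g. ereal (- (1 / ln (1 - g))) * ln_ext (measure (\<mu> g) U))
           \<ge> - (INF X\<in>U. rate A C Q R Pstar X))
    \<and> (\<forall>F. closedin psd_topology F \<longrightarrow>
         Limsup (at_left 1) (\<lambda>g. ereal (- (1 / ln (1 - g))) * ln_ext (measure (\<mu> g) F))
           \<le> - (INF X\<in>F. rate A C Q R Pstar X))"
proof -
  interpret stationary_riccati A Q C R Pstar
    using assms(1-5) by unfold_locales
  let ?s = "\<lambda>B g. ereal (- (1 / ln (1 - g))) * ln_ext (measure (\<mu> g) B)"
  have lower: "- (INF X\<in>U. rate A C Q R Pstar X) \<le> Liminf (at_left 1) (?s U)"
    if U: "openin (top_of_set psd) U" for U
  proof -
    \<comment> \<open>The infimum of the rate over \<open>U\<close> is an infimum over all strings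
      with value in \<open>U\<close>, so one string at a time is enough.\<close>
    have "- Liminf (at_left 1) (?s U) \<le> ereal (real (length (filter Not bs)))"
      if "foldr (f_idx A C Q R) bs Pstar \<in> U" for bs
    proof -
      let ?n = "length (filter Not bs)"
      obtain K where K: "0 < K" "\<And>g M. 1 / 2 \<le> g \<Longrightarrow> g < 1 \<Longrightarrow> invariant_distribution A C Q R g M
          \<Longrightarrow> K * (1 - g) ^ ?n \<le> measure M U"
        using invariant_lower[OF U \<open>foldr _ bs Pstar \<in> U\<close>] by blast
      have "ereal (- real ?n) = Liminf (at_left 1) (\<lambda>g. ereal (- (1 / ln (1 - g))) * ln_ext (K * (1 - g) ^ ?n))"
        by (rule lim_imp_Liminf[OF _ scaled_ln_ext_limit[OF K(1)], symmetric]) simp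
      also have "\<dots> \<le> Liminf (at_left 1) (?s U)"
      proof (rule Liminf_mono, rule eventually_at_leftI[of "1 / 2"])
        fix g :: real assume g: "g \<in> {1 / 2<..<1}"
        show "ereal (- (1 / ln (1 - g))) * ln_ext (K * (1 - g) ^ ?n) \<le> ?s U g"
          using g K(1) K(2)[of g "\<mu> g"] assms(6)[of g] by (intro scaled_ln_ext_mono) auto
      qed simp
      finally show ?thesis
        by (simp add: ereal_uminus_le_reorder)
    qed
    then have "- Liminf (at_left 1) (?s U) \<le> (INF X\<in>U. rate A C Q R Pstar X)"
      unfolding rate_eq by (intro INF_greatest) auto
    then show ?thesis
      by (simp add: ereal_uminus_le_reorder)
  qed
  have upper_level: "Limsup (at_left 1) (?s E) \<le> ereal (- real n)"
    if E: "closedin (top_of_set psd) E" "E \<inter> level n = {}" for E n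
  proof -
    obtain K where K: "0 < K" "\<And>g M. 0 < g \<Longrightarrow> g < 1 \<Longrightarrow> invariant_distribution A C Q R g M
        \<Longrightarrow> measure M E \<le> K * (1 - g) ^ n"
      using invariant_upper[OF E] by blast
    have "Limsup (at_left 1) (?s E) \<le> Limsup (at_left 1) (\<lambda>g. ereal (- (1 / ln (1 - g))) * ln_ext (K * (1 - g) ^ n))"
    proof (rule Limsup_mono, rule eventually_at_leftI[of 0])
      fix g :: real assume g: "g \<in> {0<..<1}"
      show "?s E g \<le> ereal (- (1 / ln (1 - g))) * ln_ext (K * (1 - g) ^ n)"
        using g K(2)[of g "\<mu> g"] assms(6)[of g] by (intro scaled_ln_ext_mono) auto
    qed simp
    also have "\<dots> = ereal (- real n)"
      by (rule lim_imp_Limsup[OF _ scaled_ln_ext_limit[OF K(1)]]) simp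
    finally show ?thesis .
  qed
  have upper: "Limsup (at_left 1) (?s E) \<le> - (INF X\<in>E. rate A C Q R Pstar X)"
    if E: "closedin (top_of_set psd) E" for E
  proof (cases "\<forall>n. E \<inter> level n = {}")
    case True
    then have *: "Limsup (at_left 1) (?s E) \<le> ereal (- real n)" for n
      using upper_level[OF E] by blast
    \<comment> \<open>Every exponent \<open>n\<close> is available here, so the upper limit lies
      below every real number.\<close>
    have "Limsup (at_left 1) (?s E) = - \<infinity>"
    proof (rule ereal_bot)
      fix B :: real
      obtain n :: nat where "- B \<le> real n"
        using real_arch_simple by blast
      then have "ereal (- real n) \<le> ereal B" by simp
      then show "Limsup (at_left 1) (?s E) \<le> ereal B"
        using *[of n] by (rule order_trans[rotated])
    qed
    then show ?thesis by simp
  next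
    case False
    \<comment> \<open>Minimality of \<open>N\<close> gives both halves: \<open>E\<close> misses
      \<open>level n\<close>, which yields the exponent \<open>n\<close>, and meets
      \<open>level (Suc n)\<close>, where the rate is at most \<open>n\<close>. \<open>N\<close> is
      a successor because \<open>level 0\<close> is empty.\<close>
    define N where "N = (LEAST n. E \<inter> level n \<noteq> {})"
    have N: "E \<inter> level N \<noteq> {}"
      unfolding N_def using False LeastI_ex[of "\<lambda>n. E \<inter> level n \<noteq> {}"] by blast
    then obtain n where n: "N = Suc n"
      by (cases N) auto
    have "E \<inter> level n = {}"
      using not_less_Least[of n "\<lambda>n. E \<inter> level n \<noteq> {}"] n unfolding N_def by auto
    then have "Limsup (at_left 1) (?s E) \<le> - ereal (real n)"
      using upper_level[OF E] by simp
    also obtain X where "X \<in> E" "X \<in> level (Suc n)"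
      using N n by blast
    then have "(INF X\<in>E. rate A C Q R Pstar X) \<le> ereal (real n)"
      using rate_le_iff[of "real n" X] by (intro INF_lower2[of X]) auto
    then have "- ereal (real n) \<le> - (INF X\<in>E. rate A C Q R Pstar X)"
      by (simp only: ereal_minus_le_minus)
    finally show ?thesis .
  qed
  show ?thesis
    using lower_semicontinuous_rate compactin_sublevel lower upper unfolding psd_topology_eq by blast
qed

end
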